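(* Consider the clipped stochastic subgradient method (C-SsGM), let $\gamma,\lambda>0$, $\mathsf x_*\in\operatorname{argmin}_{\mathsf X} f$, $f_*=\min_{\mathsf X} f$, and $$\bar c=2\left(\frac{a_p}{\lambda^{p-1}}\right)^2+b_p\max\{L_\varepsilon,\lambda\}^{2-p}.$$ Then the following hold. (i) (Anytime.) Suppose that $\gamma_k=\gamma/(k(1+\log k))^{1/p}$ and $\lambda_k=\max\{L_\varepsilon,\lambda(k(1+\log k))^{1/p}\}$ for every $k\in\mathbb N$. Then, for every $k\in\mathbb N$, $$\mathbb E[f(\bar x_k)]-f_*\le\frac{(1+\log k)^{1/p}\,(1+\log(1+\log k))^2}{k^{(p-1)/p}}\left[\frac{\|x_1-\mathsf x_*\|^2}{\gamma}+\gamma\bar c\right].$$ (ii) (Finite horizon.) For every $k\in\mathbb N$, if the algorithm is run with the constant parameters $\gamma_i=\gamma/k^{1/p}$ and $\lambda_i=\max\{L_\varepsilon,\lambda k^{1/p}\}$ for $1\le i\le k$, then $$\mathbb E[f(\bar x_k)]-f_*\le\frac{1}{k^{(p-1)/p}}\left[\frac{\|x_1-\mathsf x_*\|^2}{\gamma}+\gamma\bar c\right].$$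
   Context: Setting. $\mathsf H$ is a real separable Hilbert space; $f:\mathsf H\to\mathbb R$ is convex and Lipschitz continuous with constant $L>0$; $\mathsf X\subset\mathsf H$ is nonempty, closed and convex, with orthogonal projection $P_{\mathsf X}$; $\operatorname{argmin}_{\mathsf X} f\ne\varnothing$. $\xi$ is a random variable and for every $\mathsf x\in\mathsf X$, $\hat u(\mathsf x,\xi)$ is an $\mathsf H$-valued random vector ($\hat u$ jointly measurable) with $\mathbb E\|\hat u(\mathsf x,\xi)\|<\infty$ and $\mathbb E[\hat u(\mathsf x,\xi)]\in\partial f(\mathsf x)$ (convex subdifferential). For some $p\in\,]1,2]$ and $\sigma\ge 0$, $\mathbb E\|\hat u(\mathsf x,\xi)-\mathbb E[\hat u(\mathsf x,\xi)]\|^p\le\sigma^p$ for every $\mathsf x\in\mathsf X$. Constants. Fix a batch size $m\ge1$ and $\varepsilon>0$. Let $\sigma_m\ge0$ be such that for all $\mathsf x\in\mathsf X$, $\mathbb E\|\bar u-\mathbb E\bar u\|^p\le\sigma_m^p$, where $\bar u=\frac1m\sum_{i=1}^m\hat u(\mathsf x,\xi_i)$ with $\xi_1,\dots,\xi_m$ i.i.d. copies of $\xi$. Set $a_p=(1+1/\varepsilon)^{p-1}\sigma_m^p$, $b_p=2^{p-1}(\sigma_m^p+L^p)$, $L_\varepsilon=(1+\varepsilon)L$. Algorithm (C-SsGM). For $\mathsf u\in\mathsf H$ and $\lambda>0$ let $\mathrm{CLIP}(\mathsf u,\lambda)=\max\{\|\mathsf u\|/\lambda,1\}^{-1}\mathsf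 u$. Given stepsizes $\gamma_k>0$, clipping levels $\lambda_k>0$ and a deterministic $x_1\in\mathsf X$, for $k=1,2,\dots$: draw $\boldsymbol\xi^k=(\xi^k_1,\dots,\xi^k_m)$, $m$ independent copies of $\xi$ (the $\boldsymbol\xi^k$ being mutually independent); set $\bar u_k=\frac1m\sum_{j=1}^m\hat u(x_k,\xi^k_j)$, $\tilde u_k=\mathrm{CLIP}(\bar u_k,\lambda_k)$, $x_{k+1}=P_{\mathsf X}(x_k-\gamma_k\tilde u_k)$. The average iterate is $\bar x_k=\frac1k\sum_{i=1}^k x_i$. *)

theory Defs
  imports "HOL-Probability.Probability"
begin

definition subdifferential :: "('a::real_inner \<Rightarrow> real) \<Rightarrow> 'a \<Rightarrow> 'a set" where
  "subdifferential f x = {v. \<forall>y. f y \<ge> f x + inner v (y - x)}"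

(* Same formula as the library's closest_point, which is restricted to the class heine_borel
   and therefore excludes infinite-dimensional Hilbert spaces. *)
definition proj :: "'a::real_inner set \<Rightarrow> 'a \<Rightarrow> 'a" where
  "proj X a = (SOME x. x \<in> X \<and> (\<forall>y\<in>X. dist a x \<le> dist a y))"

definition clip :: "'a::real_normed_vector \<Rightarrow> real \<Rightarrow> 'a" where
  "clip v l = inverse (max (norm v / l) 1) *\<^sub>R v"

definition iid_copies ::
  "'w measure \<Rightarrow> 'z measure \<Rightarrow> ('w \<Rightarrow> 'z) \<Rightarrow> 'i set \<Rightarrow> ('i \<Rightarrow> 'w \<Rightarrow> 'z) \<Rightarrow> bool" where
  "iid_copies M S \<xi> I zs \<longleftrightarrow>
     prob_space.indep_vars M (\<lambda>_. S) zs I \<and> (\<forall>i\<in>I. distr M S (zs i) = distr M S \<xi>)"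

definition batch_mean ::
  "('a::real_vector \<Rightarrow> 'z \<Rightarrow> 'a) \<Rightarrow> nat \<Rightarrow> 'a \<Rightarrow> (nat \<Rightarrow> 'z) \<Rightarrow> 'a" where
  "batch_mean u m x z = (1 / real m) *\<^sub>R (\<Sum>j = 1..m. u x (z j))"

(* The iterates for a realised array of samples z, where z k j is the j-th sample drawn at
   iteration k. Iterations are numbered from 1; the value at 0 is a dummy. *)
fun cssgm ::
  "'a::real_inner set \<Rightarrow> ('a \<Rightarrow> 'z \<Rightarrow> 'a) \<Rightarrow> nat \<Rightarrow> 'a \<Rightarrow> (nat \<Rightarrow> real) \<Rightarrow> (nat \<Rightarrow> real)
     \<Rightarrow> (nat \<Rightarrow> nat \<Rightarrow> 'z) \<Rightarrow> nat \<Rightarrow> 'a" where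
  "cssgm X u m x1 \<gamma> l z 0 = x1"
| "cssgm X u m x1 \<gamma> l z (Suc 0) = x1"
| "cssgm X u m x1 \<gamma> l z (Suc (Suc n)) =
     (let k = Suc n; x = cssgm X u m x1 \<gamma> l z k
      in proj X (x - \<gamma> k *\<^sub>R clip (batch_mean u m x (z k)) (l k)))"

definition cssgm_avg ::
  "'a::real_inner set \<Rightarrow> ('a \<Rightarrow> 'z \<Rightarrow> 'a) \<Rightarrow> nat \<Rightarrow> 'a \<Rightarrow> (nat \<Rightarrow> real) \<Rightarrow> (nat \<Rightarrow> real)
     \<Rightarrow> (nat \<Rightarrow> nat \<Rightarrow> 'z) \<Rightarrow> nat \<Rightarrow> 'a" where
  "cssgm_avg X u m x1 \<gamma> l z k = (1 / real k) *\<^sub>R (\<Sum>i = 1..k. cssgm X u m x1 \<gamma> l z i)"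

end

theory Submission
  imports Defs
begin

text \<open>Clipping a vector \<open>v\<close> at a level \<open>l \<ge> (1 + \<epsilon>) L\<close>, where \<open>v\<close> has mean \<open>w\<close> with
  \<open>\<parallel>w\<parallel> \<le> L\<close>, costs a bias of at most \<open>a\<^sub>p / l\<^bsup>p - 1\<^esup>\<close> and leaves a second moment of at most
  \<open>b\<^sub>p l\<^bsup>2 - p\<^esup>\<close>. Since the projection is nonexpansive and the batch drawn at iteration \<open>k\<close> is
  independent of \<open>x\<^sub>k\<close>, Fubini's theorem turns this into
  \<open>D\<^bsub>k+1\<^esub> \<le> D\<^sub>k - 2 \<gamma>\<^sub>k \<delta>\<^sub>k + 2 \<gamma>\<^sub>k a\<^sub>p l\<^sub>k\<^bsup>1 - p\<^esup> \<surd>D\<^sub>k + \<gamma>\<^sub>k\<^sup>2 b\<^sub>p l\<^sub>k\<^bsup>2 - p\<^esup>\<close> for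
  \<open>D\<^sub>k = E \<parallel>x\<^sub>k - x\<^sub>*\<parallel>\<^sup>2\<close> and \<open>\<delta>\<^sub>k = E f(x\<^sub>k) - f\<^sub>*\<close>.
  With \<open>\<gamma>\<^sub>k = \<gamma> / s\<^sub>k\<close>, \<open>l\<^sub>k = max {L\<^sub>\<epsilon>, \<lambda> s\<^sub>k}\<close> and \<open>s\<^sub>k \<ge> 1\<close> both error terms carry the same weight
  \<open>s\<^sub>k\<^bsup>-p\<^esup>\<close>. The distances are a priori bounded, because a clipped step is, so everything is
  integrable; the term linear in \<open>\<surd>D\<^sub>k\<close> is absorbed at the index where it is largest. Jensen's
  inequality passes to the average iterate. The two parameter choices are \<open>s\<^sub>i\<^bsup>p\<^esup> = i (1 + log i)\<close>,
  whose weights sum to at most \<open>1 + log (1 + log k)\<close>, and \<open>s\<^sub>i\<^bsup>p\<^esup> = k\<close>, whose weights sum to \<open>1\<close>.\<close>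

subsection \<open>Projection and clipping\<close>

text \<open>A minimizing sequence is Cauchy by the parallelogram law: midpoints of its terms stay in
  the convex set \<open>S\<close>, so they are at distance at least \<open>d\<close> from
  \<open>a\<close>. Completeness and closedness then supply the limit, without any
  compactness.\<close>

lemma ex_closest_point_Hilbert:
  fixes S :: "'a::{real_inner, complete_space} set"
  assumes "convex S" "closed S" "S \<noteq> {}"
  shows "\<exists>x\<in>S. \<forall>y\<in>S. dist a x \<le> dist a y"
proof -
  define d where "d = infdist a S"
  have d0: "d \<ge> 0" by (simp add: d_def infdist_nonneg)
  have d_le: "d \<le> dist a y" if "y \<in> S" for y
    using that by (simp add: d_def infdist_le)
  have "\<exists>y\<in>S. dist a y < d + 1 / real (Suc n)" for n
  proof (rule ccontr)
    assume "\<not> (\<exists>y\<in>S. dist a y < d + 1 / real (Suc n))"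
    then have "d + 1 / real (Suc n) \<le> (INF y\<in>S. dist a y)"
      using assms(3) by (intro cINF_greatest) (auto simp: not_less)
    then show False
      using assms(3) by (simp add: d_def infdist_def)
  qed
  then obtain y where yS: "\<And>n. y n \<in> S" and yd: "\<And>n. dist a (y n) < d + 1 / real (Suc n)"
    by metis
  have parallelogram: "(dist (y i) (y j))\<^sup>2 \<le> (8 * d + 4) * (1 / real (Suc n))" if "i \<ge> n" "j \<ge> n" for i j n
  proof -
    let ?e = "1 / real (Suc n)"
    have e: "0 \<le> ?e" "?e \<le> 1" by auto
    have le: "dist a (y k) \<le> d + ?e" if "k \<ge> n" for k
    proof -
      have "1 / real (Suc k) \<le> ?e" using that by (auto simp: field_simps)
      then show ?thesis using yd[of k] by linarith
    qed
    have "(1/2) *\<^sub>R y i + (1/2) *\<^sub>R y j \<in> S"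
      using assms(1) yS by (intro convexD) auto
    then have mid: "d \<le> norm (a - ((1/2) *\<^sub>R y i + (1/2) *\<^sub>R y j))"
      using d_le by (auto simp: dist_norm)
    have "(dist (y i) (y j))\<^sup>2 = 2 * (norm (a - y i))\<^sup>2 + 2 * (norm (a - y j))\<^sup>2
        - 4 * (norm (a - ((1/2) *\<^sub>R y i + (1/2) *\<^sub>R y j)))\<^sup>2"
      unfolding dist_norm power2_norm_eq_inner
      by (simp add: inner_diff_left inner_diff_right inner_add_left inner_add_right
          inner_commute algebra_simps)
    also have "\<dots> \<le> 2 * (d + ?e)\<^sup>2 + 2 * (d + ?e)\<^sup>2 - 4 * d\<^sup>2"
      using le[OF that(1)] le[OF that(2)] mid d0
      by (intro diff_mono add_mono mult_left_mono power_mono) (auto simp: dist_norm)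
    also have "\<dots> = 8 * d * ?e + 4 * ?e * ?e"
      by (simp add: power2_eq_square algebra_simps)
    \<comment> \<open>Using \<open>?e \<le> 1\<close> on the quadratic term makes the whole bound a
      multiple of \<open>?e\<close>, so a single Archimedean choice of \<open>n\<close> suffices
      below.\<close>
    also have "\<dots> \<le> 8 * d * ?e + 4 * ?e"
      using mult_left_le[OF e(2), of "4 * ?e"] e(1) by linarith
    finally show ?thesis by (simp add: algebra_simps add_divide_distrib)
  qed
  have "Cauchy y"
  proof (rule metric_CauchyI)
    fix r :: real assume r: "r > 0"
    obtain n where n: "(8 * d + 4) / r\<^sup>2 < real n"
      using reals_Archimedean2 by blast
    have "(8 * d + 4) * (1 / real (Suc n)) < r\<^sup>2"
    proof -
      have "8 * d + 4 < r\<^sup>2 * real (Suc n)"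
        using n r by (simp add: field_simps) (smt (verit) zero_less_power)
      then show ?thesis by (simp add: field_simps)
    qed
    then have "dist (y i) (y j) < r" if "i \<ge> n" "j \<ge> n" for i j
      using parallelogram[OF that] r by (intro power2_less_imp_less[of _ r]) auto
    then show "\<exists>n. \<forall>i\<ge>n. \<forall>j\<ge>n. dist (y i) (y j) < r" by blast
  qed
  then obtain x where x: "y \<longlonglongrightarrow> x"
    using Cauchy_convergent convergent_def by blast
  have xS: "x \<in> S"
    using closed_sequentially[OF assms(2)] yS x by blast
  have "dist a x \<le> d"
  proof (rule LIMSEQ_le)
    show "(\<lambda>n. dist a (y n)) \<longlonglongrightarrow> dist a x"
      using x by (intro tendsto_intros)
    have "(\<lambda>n. d + 1 / real (Suc n)) \<longlonglongrightarrow> d + 0"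
      by (intro tendsto_add tendsto_const LIMSEQ_Suc[OF lim_1_over_n])
    then show "(\<lambda>n. d + 1 / real (Suc n)) \<longlonglongrightarrow> d" by simp
    show "\<exists>N. \<forall>n\<ge>N. dist a (y n) \<le> d + 1 / real (Suc n)"
      using yd less_imp_le by blast
  qed
  then show ?thesis
    using xS d_le by (meson order_trans)
qed

lemma
  fixes X :: "'a::{real_inner, complete_space} set"
  assumes "convex X" "closed X" "X \<noteq> {}"
  shows proj_in: "proj X a \<in> X"
    and proj_dist_le: "y \<in> X \<Longrightarrow> dist a (proj X a) \<le> dist a y"
proof -
  have "proj X a \<in> X \<and> (\<forall>y\<in>X. dist a (proj X a) \<le> dist a y)"
    unfolding proj_def
    using ex_closest_point_Hilbert[OF assms, of a]
    by (intro someI_ex[of "\<lambda>x. x \<in> X \<and> (\<forall>y\<in>X. dist a x \<le> dist a y)"]) blast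
  then show "proj X a \<in> X" "y \<in> X \<Longrightarrow> dist a (proj X a) \<le> dist a y" by auto
qed

lemma proj_self:
  fixes X :: "'a::{real_inner, complete_space} set"
  assumes "convex X" "closed X" "a \<in> X"
  shows "proj X a = a"
  using proj_dist_le[of X a a] assms by force

text \<open>Adding the obtuse-angle inequalities at the two projections bounds their squared
  distance by an inner product; Cauchy-Schwarz then cancels one factor.\<close>

lemma proj_nonexpansive:
  fixes X :: "'a::{real_inner, complete_space} set"
  assumes "convex X" "closed X" "X \<noteq> {}"
  shows "norm (proj X a - proj X b) \<le> norm (a - b)"
proof -
  note in_X = proj_in[OF assms]
  have a: "inner (a - proj X a) (proj X b - proj X a) \<le> 0"
    using any_closest_point_dot[OF assms(1,2) in_X in_X] proj_dist_le[OF assms] by blast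
  have b: "inner (b - proj X b) (proj X a - proj X b) \<le> 0"
    using any_closest_point_dot[OF assms(1,2) in_X in_X] proj_dist_le[OF assms] by blast
  have "(norm (proj X a - proj X b))\<^sup>2 \<le> inner (a - b) (proj X a - proj X b)"
    using a b unfolding power2_norm_eq_inner
    by (simp add: inner_diff_left inner_diff_right inner_commute)
  also have "\<dots> \<le> norm (a - b) * norm (proj X a - proj X b)"
    by (rule norm_cauchy_schwarz)
  finally show ?thesis
    by (cases "norm (proj X a - proj X b) = 0") (auto simp: power2_eq_square)
qed

lemma continuous_on_proj:
  fixes X :: "'a::{real_inner, complete_space} set"
  assumes "convex X" "closed X" "X \<noteq> {}"
  shows "continuous_on A (proj X)"
proof -
  have "1-lipschitz_on A (proj X)"
    using proj_nonexpansive[OF assms] by (intro lipschitz_onI) (auto simp: dist_norm)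
  then show ?thesis by (rule lipschitz_on_continuous_on)
qed

section \<open>Pointwise estimates for clipping\<close>

lemma clip_eq:
  assumes "l > 0"
  shows "clip v l = (if norm v \<le> l then v else (l / norm v) *\<^sub>R v)"
proof (cases "norm v \<le> l")
  case True
  then show ?thesis using assms by (simp add: clip_def max_def)
next
  case False
  then have "norm v / l > 1" using assms by simp
  then show ?thesis using False by (simp add: clip_def max_def)
qed

lemma norm_clip:
  assumes "l > 0"
  shows "norm (clip v l) = min (norm v) l"
  using assms by (auto simp: clip_eq min_def)

lemma norm_clip_diff:
  assumes "l > 0"
  shows "norm (clip v l - v) = max (norm v - l) 0"
proof (cases "norm v \<le> l")
  case False
  have "clip v l - v = (l / norm v - 1) *\<^sub>R v"
    using False assms by (simp add: clip_eq algebra_simps)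
  then have "norm (clip v l - v) = \<bar>l / norm v - 1\<bar> * norm v" by simp
  also have "\<dots> = norm v - l"
    using False assms by (cases "v = 0") (auto simp: abs_if field_simps)
  finally show ?thesis using False by simp
qed (use assms in \<open>simp add: clip_eq\<close>)

lemma clip_measurable [measurable]:
  "(\<lambda>v::'a::{real_normed_vector, second_countable_topology}. clip v l) \<in> borel_measurable borel"
  unfolding clip_def by measurable

text \<open>Markov's device: the excess of \<open>d\<close> over \<open>t\<close> vanishes unless \<open>d / t \<ge> 1\<close>, and then
  \<open>d \<le> d * (d / t) powr (p - 1)\<close>.\<close>

lemma excess_le_powr:
  assumes "d \<ge> 0" "t > 0" "p \<ge> (1::real)"
  shows "max (d - t) 0 \<le> d powr p / t powr (p - 1)"
proof (cases "d \<le> t")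
  case False
  then have "1 \<le> (d / t) powr (p - 1)"
    using assms by (intro ge_one_powr_ge_zero) auto
  then have "d * 1 \<le> d * (d / t) powr (p - 1)"
    using assms by (intro mult_left_mono) auto
  also have "\<dots> = d powr p / t powr (p - 1)"
    using False assms by (simp add: powr_divide powr_diff)
  finally have "d - t \<le> d powr p / t powr (p - 1)" using assms by simp
  then show ?thesis by simp
qed simp

text \<open>The level splits as \<open>l = t + l / (1 + \<epsilon>)\<close>, where the second
  summand pays for \<open>norm w \<le> L\<close>. Hence \<open>norm v - l\<close> is at most
  \<open>norm (v - w) - t\<close>, to which \<open>excess_le_powr\<close> applies. The factor
  \<open>1 + 1 / \<epsilon>\<close> is \<open>l / t\<close>.\<close>

lemma clip_bias_pointwise:
  assumes "L > 0" "\<epsilon> > 0" "l \<ge> (1 + \<epsilon>) * L" "norm w \<le> L" "p \<ge> 1"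
  shows "norm (clip v l - v) \<le> (1 + 1 / \<epsilon>) powr (p - 1) / l powr (p - 1) * norm (v - w) powr p"
proof -
  define t where "t = l / (1 + 1 / \<epsilon>)"
  have "0 < (1 + \<epsilon>) * L" using assms by simp
  then have l: "l > 0" using assms(3) by linarith
  then have t: "t > 0" using assms by (simp add: t_def field_simps add_pos_pos)
  have "l - t = l / (1 + \<epsilon>)" using assms by (simp add: t_def field_simps)
  moreover have "l / (1 + \<epsilon>) \<ge> L" using assms by (simp add: field_simps)
  moreover have "norm v \<le> norm (v - w) + norm w"
    by (metis diff_add_cancel norm_triangle_ineq)
  ultimately have "norm v - l \<le> norm (v - w) - t" using assms by linarith
  then have "norm (clip v l - v) \<le> max (norm (v - w) - t) 0"
    unfolding norm_clip_diff[OF l] by linarith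
  also have "\<dots> \<le> norm (v - w) powr p / t powr (p - 1)"
    using t assms by (intro excess_le_powr) auto
  also have "t powr (p - 1) = l powr (p - 1) / (1 + 1 / \<epsilon>) powr (p - 1)"
    using l assms by (simp add: t_def powr_divide)
  finally show ?thesis by (simp add: mult.commute)
qed

text \<open>Convexity of the power function at a midpoint. It is applied on the open half-line, so
  zero arguments form a case of their own.\<close>

lemma powr_add_le:
  assumes "a \<ge> 0" "b \<ge> 0" "p \<ge> (1::real)"
  shows "(a + b) powr p \<le> 2 powr (p - 1) * (a powr p + b powr p)"
proof (cases "a = 0 \<or> b = 0")
  case True
  have "1 * x powr p \<le> 2 powr (p - 1) * x powr p" for x :: real
    using assms by (intro mult_right_mono ge_one_powr_ge_zero) auto
  then show ?thesis using True assms by auto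
next
  case False
  then have ab: "a \<in> {0<..}" "b \<in> {0<..}" using assms by auto
  have "((1 - 1/2) *\<^sub>R a + (1/2) *\<^sub>R b) powr p \<le> (1 - 1/2) * a powr p + (1/2) * b powr p"
    by (rule convex_onD[OF powr_convex[OF assms(3)] _ _ ab]) auto
  then have "((a + b) / 2) powr p \<le> (a powr p + b powr p) / 2"
    by (simp add: add_divide_distrib)
  then have "2 powr p * ((a + b) / 2) powr p \<le> 2 powr p * ((a powr p + b powr p) / 2)"
    by (intro mult_left_mono) auto
  also have "2 powr p * ((a + b) / 2) powr p = (2 * ((a + b) / 2)) powr p"
    using ab powr_mult[of 2 "(a + b) / 2" p] by simp
  also have "2 * ((a + b) / 2) = a + b" by simp
  also have "2 powr p * ((a powr p + b powr p) / 2) = 2 powr (p - 1) * (a powr p + b powr p)"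
    by (simp add: powr_diff)
  finally show ?thesis .
qed

text \<open>The square splits into the powers \<open>2 - p\<close> and \<open>p\<close> of the
  clipped norm: the first is bounded through the level \<open>l\<close>, the second through
  \<open>norm v \<le> norm (v - w) + L\<close>. Thus only the \<open>p\<close>-th power of the
  deviation appears.\<close>

lemma clip_square_pointwise:
  assumes "l > 0" "norm w \<le> L" "1 \<le> p" "p \<le> 2"
  shows "(norm (clip v l))\<^sup>2
    \<le> l powr (2 - p) * (2 powr (p - 1) * (norm (v - w) powr p + L powr p))"
proof (cases "v = 0")
  case False
  let ?c = "norm (clip v l)"
  have c: "?c > 0" "?c \<le> l" "?c \<le> norm v" using False assms by (auto simp: norm_clip)
  have v: "norm v \<le> norm (v - w) + L"
    using assms(2) norm_triangle_ineq[of "v - w" w] by simp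
  have L: "L \<ge> 0" using assms(2) norm_ge_zero order_trans by blast
  have "?c\<^sup>2 = ?c powr (2 - p) * ?c powr p"
    using c by (simp flip: powr_add powr_numeral)
  also have "\<dots> \<le> l powr (2 - p) * (norm (v - w) + L) powr p"
    using c assms v by (intro mult_mono powr_mono2) auto
  also have "\<dots> \<le> l powr (2 - p) * (2 powr (p - 1) * (norm (v - w) powr p + L powr p))"
    using L assms by (intro mult_left_mono powr_add_le) auto
  finally show ?thesis .
next
  case True
  then have "clip v l = 0" by (simp add: clip_def)
  then show ?thesis by (simp add: add_nonneg_nonneg)
qed

text \<open>The subgradient inequality is tested at \<open>x + v\<close>, that is, in the direction
  of the subgradient itself.\<close>

lemma subdifferential_norm_le:
  assumes "L-lipschitz_on UNIV f" "v \<in> subdifferential f x"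
  shows "norm v \<le> L"
proof -
  have "f x + inner v ((x + v) - x) \<le> f (x + v)"
    using assms(2) unfolding subdifferential_def by blast
  then have "norm v * norm v \<le> f (x + v) - f x"
    by (simp add: power2_norm_eq_inner flip: power2_eq_square)
  also have "\<dots> \<le> dist (f (x + v)) (f x)" by (simp add: dist_norm)
  also have "\<dots> \<le> L * norm v"
    using lipschitz_onD[OF assms(1), of "x + v" x] by (simp add: dist_norm)
  finally show ?thesis
    using lipschitz_on_nonneg[OF assms(1)] by (cases "v = 0") auto
qed

section \<open>Deterministic recursions and sums\<close>

text \<open>Every \<open>e i\<close> is replaced by the maximum \<open>E\<close>, after which the
  recursion telescopes. Telescoping up to the index where \<open>E\<close> is attained bounds
  \<open>E^2\<close>, and Young's inequality absorbs the term linear in \<open>E\<close>.\<close>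

lemma perturbed_recursion_sum_le:
  fixes D e s w :: "nat \<Rightarrow> real"
  assumes "a \<ge> 0" "b \<ge> 0" and k: "k \<ge> 1"
    and w: "\<And>i. i \<in> {1..k} \<Longrightarrow> w i \<ge> 0" and s: "\<And>i. i \<in> {1..k} \<Longrightarrow> s i \<ge> 0"
    and e: "\<And>i. i \<in> {1..k} \<Longrightarrow> e i \<ge> 0" "\<And>i. i \<in> {1..k} \<Longrightarrow> (e i)\<^sup>2 \<le> D i"
    and D: "D (Suc k) \<ge> 0"
    and step: "\<And>i. i \<in> {1..k} \<Longrightarrow> D (Suc i) \<le> D i - 2 * s i + 2 * a * w i * e i + b * w i"
  shows "(\<Sum>i=1..k. s i) \<le> D 1 + 2 * a\<^sup>2 * (\<Sum>i=1..k. w i)\<^sup>2 + b * (\<Sum>i=1..k. w i)"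
proof -
  define W where "W = (\<Sum>i=1..k. w i)"
  define E where "E = Max (e ` {1..k})"
  obtain n where n: "n \<in> {1..k}" "E = e n"
    using Max_in[of "e ` {1..k}"] k unfolding E_def by fastforce
  have E_ge: "e i \<le> E" if "i \<in> {1..k}" for i
    unfolding E_def using that by (intro Max_ge) auto
  have E0: "E \<ge> 0" using n e(1) by simp
  have W0: "W \<ge> 0" unfolding W_def using w by (intro sum_nonneg) auto
  have telescope: "D (Suc j) + 2 * (\<Sum>i=1..j. s i) \<le> D 1 + (2 * a * E + b) * (\<Sum>i=1..j. w i)"
    if "j \<le> k" for j
    using that
  proof (induction j)
    case (Suc j)
    have i: "Suc j \<in> {1..k}" using Suc.prems by auto
    have "2 * a * w (Suc j) * e (Suc j) \<le> 2 * a * w (Suc j) * E"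
      using i w assms(1) E_ge by (intro mult_left_mono) auto
    then show ?case
      using Suc step[OF i] by (simp add: algebra_simps)
  qed simp
  have part: "(\<Sum>i=1..j. w i) \<le> W" "0 \<le> (\<Sum>i=1..j. s i)" if "j \<le> k" for j
    unfolding W_def using that w s by (auto intro!: sum_mono2 sum_nonneg)
  \<comment> \<open>Summing only to the predecessor of \<open>n\<close> leaves \<open>D n\<close> on
    the left-hand side, which dominates \<open>E^2\<close>.\<close>
  obtain j where j: "n = Suc j" "j \<le> k" using n by (cases n) auto
  have "E\<^sup>2 \<le> D 1 + (2 * a * E + b) * (\<Sum>i=1..j. w i)"
    using telescope[OF j(2)] part(2)[OF j(2)] e(2)[OF n(1)] n j by simp
  also have "\<dots> \<le> D 1 + (2 * a * E + b) * W"
    using part(1)[OF j(2)] assms E0 by (intro add_left_mono mult_left_mono) auto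
  finally have E2: "E\<^sup>2 \<le> D 1 + 2 * a * E * W + b * W" by (simp add: algebra_simps)
  \<comment> \<open>Young's inequality with weight 1/2 on \<open>E^2\<close>: combined with
    \<open>E2\<close>, half of \<open>2 * a * E * W\<close> remains on the right and can be moved to
    the left, giving \<open>2 * a * E * W \<le> D 1 + b * W + 4 * a^2 * W^2\<close>.\<close>
  have "0 \<le> (E - 2 * a * W)\<^sup>2" by simp
  then have "2 * a * E * W \<le> E\<^sup>2 / 2 + 2 * a\<^sup>2 * W\<^sup>2"
    by (simp add: power2_diff power_mult_distrib algebra_simps)
  moreover have "2 * (\<Sum>i=1..k. s i) \<le> D 1 + 2 * a * E * W + b * W"
    using telescope[of k] D by (simp add: W_def algebra_simps)
  ultimately show ?thesis using E2 unfolding W_def[symmetric] by linarith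
qed

text \<open>From the second one on, the summands are dominated by the increments of
  \<open>ln (1 + ln x)\<close>, by \<open>ln t \<le> t - 1\<close> used twice: for the ratio of
  consecutive integers and for the ratio of the values of \<open>1 + ln x\<close>. The first summand
  contributes the 1.\<close>

lemma sum_inverse_log_le:
  assumes "k \<ge> 1"
  shows "(\<Sum>i=1..k. 1 / (real i * (1 + ln (real i)))) \<le> 1 + ln (1 + ln (real k))"
  using assms
proof (induction k rule: dec_induct)
  case (step k)
  let ?a = "1 + ln (real k)" and ?b = "1 + ln (real (Suc k))"
  have k: "real k \<ge> 1" using step by simp
  have a: "?a > 0" "?b > 0" using k by (auto intro: add_pos_nonneg)
  have "ln (real k / real (Suc k)) \<le> real k / real (Suc k) - 1"
    using k by (intro ln_le_minus_one) auto
  then have "1 / real (Suc k) \<le> ?b - ?a"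
    using k by (simp add: ln_div field_simps)
  then have "1 / (real (Suc k) * ?b) \<le> (?b - ?a) / ?b"
    using a divide_right_mono[of "1 / real (Suc k)" "?b - ?a" ?b] by simp
  also have "\<dots> = - (?a / ?b - 1)" using a by (simp add: field_simps)
  also have "\<dots> \<le> - ln (?a / ?b)"
    using ln_le_minus_one[of "?a / ?b"] a by simp
  also have "\<dots> = ln ?b - ln ?a" using a by (simp add: ln_div)
  finally show ?case using step.IH by simp
qed simp

subsection \<open>The iterates\<close>

lemma (in prob_space) integrable_bounded:
  fixes h :: "'a \<Rightarrow> 'b::{banach, second_countable_topology}"
  assumes "h \<in> borel_measurable M" "\<And>x. x \<in> space M \<Longrightarrow> norm (h x) \<le> B"
  shows "integrable M h"
  using assms by (intro integrable_const_bound[of _ B]) auto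

section \<open>One clipped step from a fixed point\<close>

text \<open>The current point \<open>x\<close> is frozen and only the sample is random. The
  projection is nonexpansive and fixes \<open>y\<close>, so expanding the square leaves two
  expectations: that of the clipped sample, which differs from the mean of \<open>U\<close> by the
  bias, and that of its squared norm.\<close>

lemma (in prob_space) clipped_step_expectation_le:
  fixes U :: "'a \<Rightarrow> 'b::{real_inner, banach, second_countable_topology}"
  assumes X: "convex X" "closed X" "y \<in> X"
    and U: "integrable M U" "norm (expectation U) \<le> L"
    and sub: "f x + inner (expectation U) (y - x) \<le> f y"
    and moment: "(\<integral>\<^sup>+z. ennreal (norm (U z - expectation U) powr p) \<partial>M) \<le> ennreal (\<sigma> powr p)"
    and p: "1 \<le> p" "p \<le> 2"
    and pos: "L > 0" "\<epsilon> > 0" "l \<ge> (1 + \<epsilon>) * L" "g > 0"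
  shows "(\<integral>z. (norm (proj X (x - g *\<^sub>R clip (U z) l) - y))\<^sup>2 \<partial>M)
    \<le> (norm (x - y))\<^sup>2 - 2 * g * (f x - f y)
      + 2 * g * ((1 + 1 / \<epsilon>) powr (p - 1) * \<sigma> powr p / l powr (p - 1)) * norm (x - y)
      + g\<^sup>2 * (2 powr (p - 1) * (\<sigma> powr p + L powr p) * l powr (2 - p))"
proof -
  define v where "v = expectation U"
  define N where "N z = norm (U z - v) powr p" for z
  define C where "C z = clip (U z) l" for z
  define \<alpha> where "\<alpha> = (1 + 1 / \<epsilon>) powr (p - 1) / l powr (p - 1)"
  define \<beta> where "\<beta> = l powr (2 - p) * 2 powr (p - 1)"
  have "\<alpha> \<ge> 0" by (simp add: \<alpha>_def)
  have X_ne: "X \<noteq> {}" using X by auto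
  have "0 < (1 + \<epsilon>) * L" using pos by simp
  then have l: "l > 0" using pos by linarith
  have [measurable]: "U \<in> borel_measurable M" using U(1) by simp
  have [measurable]: "proj X \<in> borel_measurable borel"
    using continuous_on_proj[OF X(1,2) X_ne] by (rule borel_measurable_continuous_onI)
  have [measurable]: "C \<in> borel_measurable M" "N \<in> borel_measurable M"
    unfolding C_def N_def by measurable
  have N_fin: "(\<integral>\<^sup>+z. ennreal (N z) \<partial>M) \<le> ennreal (\<sigma> powr p)"
    using moment by (simp add: N_def v_def)
  then have N_int: "integrable M N"
    by (intro integrableI_bounded) (auto simp: N_def intro: le_less_trans)
  have N_le: "expectation N \<le> \<sigma> powr p"
    using N_fin nn_integral_eq_integral[OF N_int] by (simp add: N_def)
  have C_le: "norm (C z) \<le> l" for z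
    using l by (simp add: C_def norm_clip)
  have C_int: "integrable M C"
    by (rule integrable_bounded[where B = l]) (simp_all add: C_le)
  have bias: "norm (expectation C - v) \<le> \<alpha> * \<sigma> powr p"
  proof -
    have "expectation C - v = (\<integral>z. C z - U z \<partial>M)"
      using C_int U(1) by (simp add: v_def)
    also have "norm \<dots> \<le> (\<integral>z. norm (C z - U z) \<partial>M)" by simp
    also have "\<dots> \<le> (\<integral>z. \<alpha> * N z \<partial>M)"
    proof (rule integral_mono)
      show "norm (C z - U z) \<le> \<alpha> * N z" for z
        using clip_bias_pointwise[OF pos(1-3) U(2) p(1)] by (simp add: C_def N_def v_def \<alpha>_def)
    qed (use C_int U(1) N_int in auto)
    also have "\<dots> \<le> \<alpha> * \<sigma> powr p"
      using N_le by (simp add: mult_left_mono \<open>\<alpha> \<ge> 0\<close>)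
    finally show ?thesis .
  qed
  have "(\<integral>z. (norm (proj X (x - g *\<^sub>R clip (U z) l) - y))\<^sup>2 \<partial>M)
      \<le> (\<integral>z. (norm (x - y))\<^sup>2 - 2 * g * inner (C z) (x - y) + g\<^sup>2 * (\<beta> * (N z + L powr p)) \<partial>M)"
  proof (rule integral_mono)
    fix z
    have "norm (proj X (x - g *\<^sub>R C z) - y) \<le> norm (x - g *\<^sub>R C z - y)"
      using proj_nonexpansive[OF X(1,2) X_ne, of _ y] proj_self[OF X] by simp
    then have "(norm (proj X (x - g *\<^sub>R C z) - y))\<^sup>2 \<le> (norm (x - g *\<^sub>R C z - y))\<^sup>2"
      by (intro power_mono) auto
    also have "\<dots> = (norm (x - y))\<^sup>2 - 2 * g * inner (C z) (x - y) + g\<^sup>2 * (norm (C z))\<^sup>2"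
      unfolding power2_norm_eq_inner
      by (simp add: inner_diff_left inner_diff_right inner_commute power2_eq_square algebra_simps)
    also have "\<dots> \<le> (norm (x - y))\<^sup>2 - 2 * g * inner (C z) (x - y) + g\<^sup>2 * (\<beta> * (N z + L powr p))"
      using clip_square_pointwise[OF l U(2) p, of "U z"]
      by (intro add_left_mono mult_left_mono) (auto simp: C_def N_def v_def \<beta>_def mult.assoc)
    finally show "(norm (proj X (x - g *\<^sub>R clip (U z) l) - y))\<^sup>2
        \<le> (norm (x - y))\<^sup>2 - 2 * g * inner (C z) (x - y) + g\<^sup>2 * (\<beta> * (N z + L powr p))"
      by (simp add: C_def)
  next
    show "integrable M (\<lambda>z. (norm (proj X (x - g *\<^sub>R clip (U z) l) - y))\<^sup>2)"
    proof (rule integrable_bounded[where B = "(norm (x - y) + g * l)\<^sup>2"])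
      fix z
      have "norm (proj X (x - g *\<^sub>R C z) - y) \<le> norm (x - g *\<^sub>R C z - y)"
        using proj_nonexpansive[OF X(1,2) X_ne, of _ y] proj_self[OF X] by simp
      also have "x - g *\<^sub>R C z - y = (x - y) - g *\<^sub>R C z" by simp
      also have "norm ((x - y) - g *\<^sub>R C z) \<le> norm (x - y) + norm (g *\<^sub>R C z)" by (rule norm_triangle_ineq4)
      also have "\<dots> \<le> norm (x - y) + g * l" using C_le[of z] pos by simp
      finally show "norm ((norm (proj X (x - g *\<^sub>R clip (U z) l) - y))\<^sup>2) \<le> (norm (x - y) + g * l)\<^sup>2"
        by (simp add: C_def power_mono)
    qed measurable
  next
    show "integrable M (\<lambda>z. (norm (x - y))\<^sup>2 - 2 * g * inner (C z) (x - y)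
        + g\<^sup>2 * (\<beta> * (N z + L powr p)))"
      using C_int N_int by auto
  qed
  also have "\<dots> = (norm (x - y))\<^sup>2 - 2 * g * inner (expectation C) (x - y)
      + g\<^sup>2 * (\<beta> * (expectation N + L powr p))"
    using C_int N_int by (simp add: prob_space)
  also have "\<dots> \<le> (norm (x - y))\<^sup>2 - 2 * g * ((f x - f y) - \<alpha> * \<sigma> powr p * norm (x - y))
      + g\<^sup>2 * (\<beta> * (\<sigma> powr p + L powr p))"
  proof -
    \<comment> \<open>The clipped mean is compared with the unclipped mean \<open>v\<close>, for
      which \<open>sub\<close> gives an inner product of at least \<open>f x - f y\<close>.\<close>
    have "- inner (expectation C - v) (x - y) \<le> norm (expectation C - v) * norm (x - y)"
      using norm_cauchy_schwarz[of "- (expectation C - v)" "x - y"]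
      unfolding inner_minus_left norm_minus_cancel .
    also have "\<dots> \<le> \<alpha> * \<sigma> powr p * norm (x - y)"
      using bias by (intro mult_right_mono) auto
    finally have "(f x - f y) - \<alpha> * \<sigma> powr p * norm (x - y) \<le> inner (expectation C) (x - y)"
      using sub by (simp add: v_def inner_diff_left inner_diff_right)
    then show ?thesis
      using N_le pos by (intro add_mono diff_left_mono mult_left_mono) (auto simp: \<beta>_def)
  qed
  finally show ?thesis by (simp add: \<alpha>_def \<beta>_def algebra_simps)
qed

section \<open>Properties of the iterates for given samples\<close>

lemma cssgm_Suc:
  "k \<ge> 1 \<Longrightarrow> cssgm X u m x1 g l z (Suc k) =
    proj X (cssgm X u m x1 g l z k
      - g k *\<^sub>R clip (batch_mean u m (cssgm X u m x1 g l z k) (z k)) (l k))"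
  by (cases k) (auto simp: Let_def)

text \<open>The \<open>k\<close>-th iterate reads only the batches before \<open>k\<close>, and of
  each only the entries \<open>1..m\<close>. This causality is the source of its independence from
  batch \<open>k\<close>.\<close>

lemma cssgm_cong:
  assumes "\<And>i j. i \<in> {1..<k} \<Longrightarrow> j \<in> {1..m} \<Longrightarrow> z i j = z' i j"
  shows "cssgm X u m x1 g l z k = cssgm X u m x1 g l z' k"
  using assms
proof (induction k)
  case (Suc k)
  show ?case
  proof (cases "k = 0")
    case False
    have "batch_mean u m x (z k) = batch_mean u m x (z' k)" for x
      using Suc.prems[of k] False by (simp add: batch_mean_def)
    then show ?thesis using Suc False by (simp add: cssgm_Suc)
  qed simp
qed simp

lemma cssgm_in:
  fixes X :: "'a::{real_inner, complete_space} set"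
  assumes "convex X" "closed X" "x1 \<in> X"
  shows "cssgm X u m x1 g l z k \<in> X"
proof (cases "k \<le> 1")
  case True
  then have "k = 0 \<or> k = Suc 0" by auto
  then show ?thesis using assms by auto
next
  case False
  then obtain n where "k = Suc n" "n \<ge> 1" by (cases k) auto
  then show ?thesis using assms by (auto simp: cssgm_Suc intro!: proj_in)
qed

text \<open>A step clipped at level \<open>l i\<close> has length at most \<open>g i * l i\<close>,
  and projecting does not increase the distance to \<open>y\<close>. The bound is uniform in the
  samples.\<close>

lemma cssgm_bounded:
  fixes X :: "'a::{real_inner, complete_space} set"
  assumes X: "convex X" "closed X" "y \<in> X"
    and "k \<ge> 1" "\<And>i. i \<in> {1..<k} \<Longrightarrow> g i > 0" "\<And>i. i \<in> {1..<k} \<Longrightarrow> l i > 0"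
  shows "norm (cssgm X u m x1 g l z k - y) \<le> norm (x1 - y) + (\<Sum>i=1..<k. g i * l i)"
  using assms(4-)
proof (induction k rule: dec_induct)
  case (step k)
  let ?x = "cssgm X u m x1 g l z k"
  let ?c = "clip (batch_mean u m ?x (z k)) (l k)"
  have "norm (proj X (?x - g k *\<^sub>R ?c) - y) \<le> norm ((?x - y) - g k *\<^sub>R ?c)"
    using proj_nonexpansive[OF X(1,2), of "?x - g k *\<^sub>R ?c" y] proj_self[OF X] X(3)
    by (auto simp: algebra_simps)
  also have "\<dots> \<le> norm (?x - y) + norm (g k *\<^sub>R ?c)" by (rule norm_triangle_ineq4)
  also have "\<dots> \<le> norm (?x - y) + g k * l k"
    using step.prems[of k] step.hyps by (simp add: norm_clip)
  finally show ?case using step by (simp add: cssgm_Suc)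
qed simp

section \<open>The method with whole batches as samples\<close>

text \<open>A batch is one random element \<open>Y k\<close> of \<open>T\<close> with law
  \<open>Q\<close>, so \<open>\<sigma>\<close> is the deviation of a batch mean; \<open>y\<close> is
  the minimizer. Mean and moment assumptions are imposed on \<open>Q\<close> and thereby hold for
  all batches at once.\<close>

locale clipped_subgradient = prob_space M
  for M :: "'w measure" +
  fixes f :: "'a::{real_inner, banach, second_countable_topology} \<Rightarrow> real"
    and X :: "'a set" and u :: "'a \<Rightarrow> 'z \<Rightarrow> 'a" and m :: nat
    and T :: "(nat \<Rightarrow> 'z) measure" and Q :: "(nat \<Rightarrow> 'z) measure"
    and Y :: "nat \<Rightarrow> 'w \<Rightarrow> nat \<Rightarrow> 'z"
    and L p \<sigma> \<epsilon> :: real and x1 y :: 'a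
  assumes f_convex: "convex_on UNIV f" and f_lipschitz: "L-lipschitz_on UNIV f"
    and L_pos: "L > 0"
    and X: "convex X" "closed X"
    and x1: "x1 \<in> X" and y: "y \<in> X" and y_min: "\<And>x. x \<in> X \<Longrightarrow> f y \<le> f x"
    and p: "1 < p" "p \<le> 2" and \<epsilon>: "\<epsilon> > 0"
    and indep: "indep_vars (\<lambda>_. T) Y {1..}"
    and distr_Y: "\<And>k. k \<ge> 1 \<Longrightarrow> distr M T (Y k) = Q"
    and batch_measurable:
      "(\<lambda>(x, z). batch_mean u m x z) \<in> borel_measurable (restrict_space borel X \<Otimes>\<^sub>M T)"
    and batch_integrable: "\<And>x. x \<in> X \<Longrightarrow> integrable Q (batch_mean u m x)"
    and batch_mean_in: "\<And>x. x \<in> X \<Longrightarrow> (\<integral>z. batch_mean u m x z \<partial>Q) \<in> subdifferential f x"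
    and batch_moment: "\<And>x. x \<in> X \<Longrightarrow>
      (\<integral>\<^sup>+z. ennreal (norm (batch_mean u m x z - (\<integral>z. batch_mean u m x z \<partial>Q)) powr p) \<partial>Q)
        \<le> ennreal (\<sigma> powr p)"
begin

definition a\<^sub>p where "a\<^sub>p = (1 + 1 / \<epsilon>) powr (p - 1) * \<sigma> powr p"
definition b\<^sub>p where "b\<^sub>p = 2 powr (p - 1) * (\<sigma> powr p + L powr p)"
definition iterate where "iterate g l \<omega> = cssgm X u m x1 g l (\<lambda>k. Y k \<omega>)"

lemma a\<^sub>p_nonneg: "a\<^sub>p \<ge> 0" and b\<^sub>p_nonneg: "b\<^sub>p \<ge> 0"
  by (simp_all add: a\<^sub>p_def b\<^sub>p_def)

lemma f_measurable [measurable]: "f \<in> borel_measurable borel"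
  using lipschitz_on_continuous_on[OF f_lipschitz] by (rule borel_measurable_continuous_onI)

lemma proj_measurable [measurable]: "proj X \<in> borel_measurable borel"
  using continuous_on_proj[OF X] x1 by (intro borel_measurable_continuous_onI) auto

lemma Y_measurable [measurable]: "k \<ge> 1 \<Longrightarrow> Y k \<in> measurable M T"
  using indep by (auto simp: indep_vars_def)

lemma iterate_in: "iterate g l \<omega> k \<in> X"
  unfolding iterate_def using X x1 by (rule cssgm_in)

text \<open>Joint measurability of the batch mean is given over \<open>X\<close> only, so the step
  is treated as a map into the subspace \<open>X\<close>, where it can be iterated.\<close>

lemma step_measurable:
  "(\<lambda>(x, z). proj X (x - g *\<^sub>R clip (batch_mean u m x z) l))
    \<in> measurable (restrict_space borel X \<Otimes>\<^sub>M T) (restrict_space borel X)"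
proof (rule measurable_restrict_space2)
  show "(\<lambda>(x, z). proj X (x - g *\<^sub>R clip (batch_mean u m x z) l))
      \<in> space (restrict_space borel X \<Otimes>\<^sub>M T) \<rightarrow> X"
    using proj_in[OF X] x1 by auto
  have [measurable]: "(\<lambda>w. batch_mean u m (fst w) (snd w))
      \<in> borel_measurable (restrict_space borel X \<Otimes>\<^sub>M T)"
    using batch_measurable by (simp add: case_prod_unfold)
  have [measurable]: "fst \<in> borel_measurable (restrict_space borel X \<Otimes>\<^sub>M T)"
    by (rule measurable_compose[OF measurable_fst, of "\<lambda>x. x"])
      (rule measurable_restrict_space1, simp)
  show "(\<lambda>(x, z). proj X (x - g *\<^sub>R clip (batch_mean u m x z) l))
      \<in> borel_measurable (restrict_space borel X \<Otimes>\<^sub>M T)"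
    unfolding case_prod_unfold by measurable
qed

text \<open>The index set \<open>J\<close> is arbitrary so that one product space serves throughout
  the induction on \<open>k\<close>.\<close>

lemma cssgm_measurable:
  assumes "k \<ge> 1" "{1..<k} \<subseteq> J"
  shows "(\<lambda>z. cssgm X u m x1 g l z k) \<in> measurable (PiM J (\<lambda>_. T)) (restrict_space borel X)"
  using assms
proof (induction k rule: dec_induct)
  case base
  then show ?case using x1 by (auto intro!: measurable_const simp: space_restrict_space)
next
  case (step k)
  have k: "k \<in> J" using step by auto
  have "(\<lambda>z. (cssgm X u m x1 g l z k, z k))
      \<in> measurable (PiM J (\<lambda>_. T)) (restrict_space borel X \<Otimes>\<^sub>M T)"
    using step k by (intro measurable_Pair measurable_component_singleton step.IH) auto
  from measurable_compose[OF this step_measurable[of "g k" "l k"]] show ?case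
    using step by (simp add: cssgm_Suc)
qed

lemma iterate_measurable_X:
  assumes "k \<ge> 1"
  shows "(\<lambda>\<omega>. iterate g l \<omega> k) \<in> measurable M (restrict_space borel X)"
proof -
  have "(\<lambda>\<omega>. \<lambda>i\<in>{1..<k}. Y i \<omega>) \<in> measurable M (PiM {1..<k} (\<lambda>_. T))"
    by (rule measurable_restrict) auto
  from measurable_compose[OF this cssgm_measurable[OF assms order_refl]]
  have "(\<lambda>\<omega>. cssgm X u m x1 g l (\<lambda>i\<in>{1..<k}. Y i \<omega>) k) \<in> measurable M (restrict_space borel X)" .
  also have "(\<lambda>\<omega>. cssgm X u m x1 g l (\<lambda>i\<in>{1..<k}. Y i \<omega>) k) = (\<lambda>\<omega>. iterate g l \<omega> k)"
    unfolding iterate_def by (intro ext cssgm_cong) auto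
  finally show ?thesis .
qed

lemma iterate_measurable [measurable]:
  "k \<ge> 1 \<Longrightarrow> (\<lambda>\<omega>. iterate g l \<omega> k) \<in> borel_measurable M"
  using iterate_measurable_X by (auto simp: measurable_restrict_space2_iff)

text \<open>Independence of an iterate and the next batch, which take values in different types, is
  stated through their joint law because \<^const>\<open>prob_space.indep_var\<close> relates variables of one type.\<close>

lemma iterate_joint_law:
  assumes "k \<ge> 1"
  shows "distr M (restrict_space borel X) (\<lambda>\<omega>. iterate g l \<omega> k) \<Otimes>\<^sub>M distr M T (Y k)
    = distr M (restrict_space borel X \<Otimes>\<^sub>M T) (\<lambda>\<omega>. (iterate g l \<omega> k, Y k \<omega>))"
proof -
  let ?A = "PiM {1..<k} (\<lambda>_. T)" and ?B = "PiM {k} (\<lambda>_. T)" and ?R = "restrict_space borel X :: 'a measure"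
  define past where "past \<omega> = restrict (\<lambda>i. Y i \<omega>) {1..<k}" for \<omega>
  define now where "now \<omega> = restrict (\<lambda>i. Y i \<omega>) {k}" for \<omega>
  define F where "F = (\<lambda>z. cssgm X u m x1 g l z k)"
  \<comment> \<open>The disjoint index blocks before \<open>k\<close> and at \<open>k\<close> yield
    independent variables of the same type. The iterate is \<open>F\<close> of the first, the batch
    is coordinate \<open>k\<close> of the second.\<close>
  have "indep_var ?A past ?B now"
    unfolding past_def now_def using assms by (intro indep_var_restrict[OF indep]) auto
  then have past [measurable]: "past \<in> measurable M ?A" and now [measurable]: "now \<in> measurable M ?B"
    and joint: "distr M ?A past \<Otimes>\<^sub>M distr M ?B now = distr M (?A \<Otimes>\<^sub>M ?B) (\<lambda>\<omega>. (past \<omega>, now \<omega>))"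
    by (auto simp: indep_var_distribution_eq)
  have F [measurable]: "F \<in> measurable ?A ?R"
    unfolding F_def using assms by (intro cssgm_measurable) auto
  have now_k [measurable]: "(\<lambda>z. z k) \<in> measurable ?B T"
    by (rule measurable_component_singleton) auto
  have F_past: "F (past \<omega>) = iterate g l \<omega> k" for \<omega>
    unfolding F_def past_def iterate_def by (intro cssgm_cong) auto
  have now_Y: "now \<omega> k = Y k \<omega>" for \<omega> by (simp add: now_def)
  have Yk: "Y k \<in> measurable M T" using assms by simp
  have laws: "distr M ?R (\<lambda>\<omega>. iterate g l \<omega> k) = distr (distr M ?A past) ?R F"
    "distr M T (Y k) = distr (distr M ?B now) T (\<lambda>z. z k)"
    by (simp_all add: distr_distr comp_def F_past now_Y del: One_nat_def)
  interpret Yk: prob_space "distr (distr M ?B now) T (\<lambda>z. z k)"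
    unfolding laws[symmetric] by (rule prob_space_distr) (rule Yk)
  have "distr (distr M ?A past) ?R F \<Otimes>\<^sub>M distr (distr M ?B now) T (\<lambda>z. z k)
      = distr (distr M (?A \<Otimes>\<^sub>M ?B) (\<lambda>\<omega>. (past \<omega>, now \<omega>))) (?R \<Otimes>\<^sub>M T) (\<lambda>(z, z'). (F z, z' k))"
    unfolding joint[symmetric]
    by (rule pair_measure_distr)
      (use F now_k Yk.sigma_finite_measure_axioms in \<open>simp_all only: measurable_distr_eq1\<close>)
  also have "\<dots> = distr M (?R \<Otimes>\<^sub>M T) (\<lambda>\<omega>. (iterate g l \<omega> k, Y k \<omega>))"
    by (subst distr_distr) (measurable, simp add: comp_def F_past now_Y)
  finally show ?thesis unfolding laws .
qed

section \<open>Descent of the expected squared distance\<close>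

definition D where "D g l k = expectation (\<lambda>\<omega>. (norm (iterate g l \<omega> k - y))\<^sup>2)"
definition gap where "gap g l k = expectation (\<lambda>\<omega>. f (iterate g l \<omega> k)) - f y"

context
  fixes g l :: "nat \<Rightarrow> real" and n :: nat
  assumes g_pos: "\<And>i. i \<in> {1..n} \<Longrightarrow> g i > 0"
    and l_ge: "\<And>i. i \<in> {1..n} \<Longrightarrow> l i \<ge> (1 + \<epsilon>) * L"
begin

lemma l_pos: "i \<in> {1..n} \<Longrightarrow> l i > 0"
proof -
  assume "i \<in> {1..n}"
  moreover have "0 < (1 + \<epsilon>) * L" using \<epsilon> L_pos by simp
  ultimately show "l i > 0" using l_ge by fastforce
qed

text \<open>Parameters are constrained only up to \<open>n\<close>, as a finite horizon prescribes
  them, and these determine all iterates up to \<open>Suc n\<close>. The uniform bound serves to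
  make the expectations below finite.\<close>

lemma iterate_bounded: "\<exists>R\<ge>0. \<forall>\<omega>. \<forall>k\<in>{1..Suc n}. norm (iterate g l \<omega> k - y) \<le> R"
proof (intro exI conjI allI ballI)
  let ?R = "norm (x1 - y) + (\<Sum>i=1..n. g i * l i)"
  have pos: "g i * l i \<ge> 0" if "i \<in> {1..n}" for i
    using g_pos[OF that] l_pos[OF that] by simp
  then show "?R \<ge> 0" by (intro add_nonneg_nonneg sum_nonneg) auto
  fix \<omega> k assume k: "k \<in> {1..Suc n}"
  have "norm (iterate g l \<omega> k - y) \<le> norm (x1 - y) + (\<Sum>i=1..<k. g i * l i)"
    unfolding iterate_def using k g_pos l_pos by (intro cssgm_bounded X y) auto
  also have "(\<Sum>i=1..<k. g i * l i) \<le> (\<Sum>i=1..n. g i * l i)"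
    using k pos by (intro sum_mono2) auto
  finally show "norm (iterate g l \<omega> k - y) \<le> ?R" by simp
qed

lemma integrable_dist: "k \<in> {1..Suc n} \<Longrightarrow> integrable M (\<lambda>\<omega>. norm (iterate g l \<omega> k - y))"
  and integrable_dist2: "k \<in> {1..Suc n} \<Longrightarrow> integrable M (\<lambda>\<omega>. (norm (iterate g l \<omega> k - y))\<^sup>2)"
  and integrable_f: "k \<in> {1..Suc n} \<Longrightarrow> integrable M (\<lambda>\<omega>. f (iterate g l \<omega> k))"
proof -
  assume k: "k \<in> {1..Suc n}"
  then have [measurable]: "(\<lambda>\<omega>. iterate g l \<omega> k) \<in> borel_measurable M" by simp
  obtain R where R: "R \<ge> 0" "\<And>\<omega>. norm (iterate g l \<omega> k - y) \<le> R"
    using iterate_bounded k by blast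
  show "integrable M (\<lambda>\<omega>. norm (iterate g l \<omega> k - y))"
    by (rule integrable_bounded[where B = R]) (use R in simp_all)
  show "integrable M (\<lambda>\<omega>. (norm (iterate g l \<omega> k - y))\<^sup>2)"
    by (rule integrable_bounded[where B = "R\<^sup>2"]) (use R in \<open>simp_all add: power_mono\<close>)
  show "integrable M (\<lambda>\<omega>. f (iterate g l \<omega> k))"
  proof (rule integrable_bounded[where B = "\<bar>f y\<bar> + L * R"])
    fix \<omega>
    have "\<bar>f (iterate g l \<omega> k) - f y\<bar> \<le> L * norm (iterate g l \<omega> k - y)"
      using lipschitz_onD[OF f_lipschitz, of "iterate g l \<omega> k" y] by (simp add: dist_norm)
    also have "\<dots> \<le> L * R" using R L_pos by simp
    finally show "norm (f (iterate g l \<omega> k)) \<le> \<bar>f y\<bar> + L * R" by simp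
  qed measurable
qed

lemma gap_nonneg: "k \<in> {1..Suc n} \<Longrightarrow> gap g l k \<ge> 0"
  using integral_mono[of M "\<lambda>_. f y" "\<lambda>\<omega>. f (iterate g l \<omega> k)"] integrable_f[of k] y_min iterate_in
  by (simp add: gap_def prob_space)

text \<open>This is nonnegativity of the variance of the distance.\<close>

lemma expected_dist_square_le:
  "k \<in> {1..Suc n} \<Longrightarrow> (expectation (\<lambda>\<omega>. norm (iterate g l \<omega> k - y)))\<^sup>2 \<le> D g l k"
  using variance_eq[OF integrable_dist integrable_dist2, of k]
    variance_positive[of "\<lambda>\<omega>. norm (iterate g l \<omega> k - y)"]
  by (simp add: D_def)

text \<open>The joint law of the iterate and its batch is a product, so Fubini's theorem integrates
  over the batch first. For each fixed \<open>v\<close> in \<open>X\<close>,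
  \<open>clipped_step_expectation_le\<close> bounds the inner integral by \<open>r v\<close>, which
  is then integrated over the law of the iterate.\<close>

lemma descent:
  assumes k: "k \<in> {1..n}"
  shows "D g l (Suc k) \<le> D g l k - 2 * g k * gap g l k
    + 2 * g k * (a\<^sub>p / l k powr (p - 1)) * expectation (\<lambda>\<omega>. norm (iterate g l \<omega> k - y))
    + (g k)\<^sup>2 * (b\<^sub>p * l k powr (2 - p))"
proof -
  let ?R = "restrict_space borel X :: 'a measure"
  define x where "x \<omega> = iterate g l \<omega> k" for \<omega>
  define P where "P = distr M ?R x"
  define h where "h w = (norm (proj X (fst w - g k *\<^sub>R clip (batch_mean u m (fst w) (snd w)) (l k)) - y))\<^sup>2"
    for w
  define r where "r v = (norm (v - y))\<^sup>2 - 2 * g k * (f v - f y)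
    + 2 * g k * (a\<^sub>p / l k powr (p - 1)) * norm (v - y) + (g k)\<^sup>2 * (b\<^sub>p * l k powr (2 - p))" for v
  have k1: "k \<ge> 1" and kn: "k \<in> {1..Suc n}" "Suc k \<in> {1..Suc n}" using k by auto
  have Q: "Q = distr M T (Y k)" using distr_Y[OF k1] by simp
  have x_meas [measurable]: "x \<in> measurable M ?R"
    using iterate_measurable_X[OF k1] by (simp add: x_def[abs_def])
  have Yk [measurable]: "Y k \<in> measurable M T" using k1 by simp
  interpret Q: prob_space Q unfolding Q by (rule prob_space_distr) simp
  interpret P: prob_space P unfolding P_def by (rule prob_space_distr) simp
  interpret PQ: pair_sigma_finite P Q ..
  have joint: "distr M (?R \<Otimes>\<^sub>M T) (\<lambda>\<omega>. (x \<omega>, Y k \<omega>)) = P \<Otimes>\<^sub>M Q"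
    using iterate_joint_law[OF k1, of g l] unfolding P_def Q x_def[abs_def] by simp
  have h_meas [measurable]: "h \<in> borel_measurable (?R \<Otimes>\<^sub>M T)"
  proof -
    have "(\<lambda>w. proj X (fst w - g k *\<^sub>R clip (batch_mean u m (fst w) (snd w)) (l k)))
        \<in> borel_measurable (?R \<Otimes>\<^sub>M T)"
      using step_measurable[of "g k" "l k"]
      by (auto simp: measurable_restrict_space2_iff case_prod_unfold)
    then show ?thesis unfolding h_def by measurable
  qed
  have h_x: "h (x \<omega>, Y k \<omega>) = (norm (iterate g l \<omega> (Suc k) - y))\<^sup>2" for \<omega>
    using k1 by (simp add: h_def x_def iterate_def cssgm_Suc)
  have h_int: "integrable (P \<Otimes>\<^sub>M Q) h"
    unfolding joint[symmetric] using integrable_dist2[OF kn(2)]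
    by (subst integrable_distr_eq) (auto simp: h_x)
  have f_R [measurable]: "f \<in> borel_measurable ?R" "(\<lambda>v. v) \<in> borel_measurable ?R"
    by (auto intro: measurable_restrict_space1)
  have r_meas [measurable]: "r \<in> borel_measurable ?R"
    unfolding r_def by measurable
  have rx_int: "integrable M (\<lambda>\<omega>. r (x \<omega>))"
    unfolding r_def x_def
    using integrable_dist[OF kn(1)] integrable_dist2[OF kn(1)] integrable_f[OF kn(1)] by auto
  have "D g l (Suc k) = (\<integral>w. h w \<partial>(P \<Otimes>\<^sub>M Q))"
    unfolding joint[symmetric] by (subst integral_distr) (auto simp: h_x D_def)
  also have "\<dots> = (\<integral>v. (\<integral>z. h (v, z) \<partial>Q) \<partial>P)"
    using PQ.integral_fst'[OF h_int] by simp
  also have "\<dots> \<le> (\<integral>v. r v \<partial>P)"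
  proof (rule integral_mono)
    show "integrable P (\<lambda>v. \<integral>z. h (v, z) \<partial>Q)"
      using PQ.integrable_fst'[OF h_int] .
    show "integrable P r"
      unfolding P_def using rx_int by (subst integrable_distr_eq) auto
    \<comment> \<open>The law \<open>P\<close> lives on the subspace \<open>X\<close>, so the
      assumptions on batches apply at every \<open>v\<close>, without exceptional null sets.\<close>
    fix v assume "v \<in> space P"
    then have v: "v \<in> X" by (simp add: P_def space_restrict_space)
    note sub = batch_mean_in[OF v]
    show "(\<integral>z. h (v, z) \<partial>Q) \<le> r v"
      unfolding h_def r_def a\<^sub>p_def b\<^sub>p_def fst_conv snd_conv
      using sub subdifferential_norm_le[OF f_lipschitz sub] p k
      by (intro Q.clipped_step_expectation_le X y batch_integrable batch_moment v L_pos \<epsilon> l_ge g_pos)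
        (auto simp: subdifferential_def)
  qed
  also have "\<dots> = expectation (\<lambda>\<omega>. r (x \<omega>))"
    unfolding P_def by (subst integral_distr) auto
  also have "\<dots> = D g l k - 2 * g k * gap g l k
    + 2 * g k * (a\<^sub>p / l k powr (p - 1)) * expectation (\<lambda>\<omega>. norm (iterate g l \<omega> k - y))
    + (g k)\<^sup>2 * (b\<^sub>p * l k powr (2 - p))"
    unfolding r_def x_def D_def gap_def
    using integrable_dist[OF kn(1)] integrable_dist2[OF kn(1)] integrable_f[OF kn(1)]
    by (simp add: prob_space)
  finally show ?thesis .
qed

end

section \<open>Rates for the average iterate\<close>

context
  fixes g l s :: "nat \<Rightarrow> real" and n :: nat and \<gamma> lam :: real
  assumes n: "n \<ge> 1" and \<gamma>: "\<gamma> > 0" and lam: "lam > 0"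
    and s_ge: "\<And>i. i \<in> {1..n} \<Longrightarrow> s i \<ge> 1"
    and g_eq: "\<And>i. i \<in> {1..n} \<Longrightarrow> g i = \<gamma> / s i"
    and l_eq: "\<And>i. i \<in> {1..n} \<Longrightarrow> l i = max ((1 + \<epsilon>) * L) (lam * s i)"
begin

lemma stepsize_pos: "i \<in> {1..n} \<Longrightarrow> g i > 0"
  using g_eq[of i] s_ge[of i] \<gamma> by simp

lemma level_ge: "i \<in> {1..n} \<Longrightarrow> l i \<ge> (1 + \<epsilon>) * L"
  using l_eq[of i] by simp

text \<open>The level lies between \<open>lam * s i\<close> and
  \<open>max ((1 + \<epsilon>) * L) lam * s i\<close>. The lower bound controls the bias term and
  the upper bound the second-moment term; in both, the powers of \<open>s i\<close> combine to
  \<open>s i powr - p\<close>, the weight fed to \<open>perturbed_recursion_sum_le\<close>.\<close>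

lemma weighted_gap_sum_le:
  "(\<Sum>i=1..n. g i * gap g l i) \<le> (norm (x1 - y))\<^sup>2
    + 2 * (\<gamma> * (a\<^sub>p / lam powr (p - 1)))\<^sup>2 * (\<Sum>i=1..n. s i powr - p)\<^sup>2
    + \<gamma>\<^sup>2 * (b\<^sub>p * max ((1 + \<epsilon>) * L) lam powr (2 - p)) * (\<Sum>i=1..n. s i powr - p)"
proof -
  define \<Lambda> where "\<Lambda> = max ((1 + \<epsilon>) * L) lam"
  define e where "e i = expectation (\<lambda>\<omega>. norm (iterate g l \<omega> i - y))" for i
  note [simp] = a\<^sub>p_nonneg b\<^sub>p_nonneg
  have e_nonneg: "e i \<ge> 0" for i by (simp add: e_def)
  have step: "D g l (Suc i) \<le> D g l i - 2 * (g i * gap g l i)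
      + 2 * (\<gamma> * (a\<^sub>p / lam powr (p - 1))) * s i powr - p * e i
      + \<gamma>\<^sup>2 * (b\<^sub>p * \<Lambda> powr (2 - p)) * s i powr - p"
    if i: "i \<in> {1..n}" for i
  proof -
    have s: "s i \<ge> 1" using s_ge i by simp
    have "g i / l i powr (p - 1) \<le> g i / (lam * s i) powr (p - 1)"
      using l_eq[OF i] stepsize_pos[OF i] lam s p
      by (intro divide_left_mono powr_mono2 mult_pos_pos) (auto simp: max_def)
    also have "\<dots> = \<gamma> / lam powr (p - 1) * s i powr - p"
      using g_eq[OF i] s lam by (simp add: powr_mult powr_diff powr_minus field_simps)
    finally have A: "g i / l i powr (p - 1) * (a\<^sub>p * e i)
        \<le> \<gamma> / lam powr (p - 1) * s i powr - p * (a\<^sub>p * e i)"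
      by (intro mult_right_mono) (auto simp: e_nonneg)
    \<comment> \<open>Here \<open>s i \<ge> 1\<close> matters: the constant floor of the level may
      be multiplied by \<open>s i\<close>.\<close>
    have "\<Lambda> * s i \<ge> max ((1 + \<epsilon>) * L) (lam * s i)"
    proof -
      have "(1 + \<epsilon>) * L * 1 \<le> \<Lambda> * s i"
        using s lam by (intro mult_mono) (auto simp: \<Lambda>_def)
      moreover have "lam * s i \<le> \<Lambda> * s i"
        using s by (intro mult_right_mono) (auto simp: \<Lambda>_def)
      ultimately show ?thesis by simp
    qed
    then have "l i powr (2 - p) \<le> (\<Lambda> * s i) powr (2 - p)"
      using p l_eq[OF i] lam s by (intro powr_mono2) (auto simp: le_max_iff_disj)
    then have "(g i)\<^sup>2 * l i powr (2 - p) \<le> (g i)\<^sup>2 * (\<Lambda> * s i) powr (2 - p)"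
      by (intro mult_left_mono) auto
    also have "\<dots> = \<gamma>\<^sup>2 * \<Lambda> powr (2 - p) * s i powr - p"
      using s lam
      by (simp add: g_eq[OF i] power_divide \<Lambda>_def powr_mult powr_diff powr_minus field_simps)
    finally have B: "b\<^sub>p * ((g i)\<^sup>2 * l i powr (2 - p)) \<le> b\<^sub>p * (\<gamma>\<^sup>2 * \<Lambda> powr (2 - p) * s i powr - p)"
      by (intro mult_left_mono) auto
    have "D g l (Suc i) \<le> D g l i - 2 * g i * gap g l i
        + 2 * g i * (a\<^sub>p / l i powr (p - 1)) * e i + (g i)\<^sup>2 * (b\<^sub>p * l i powr (2 - p))"
      unfolding e_def using i by (intro descent[where n = n] stepsize_pos level_ge) auto
    moreover have "2 * g i * (a\<^sub>p / l i powr (p - 1)) * e i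
        \<le> 2 * (\<gamma> * (a\<^sub>p / lam powr (p - 1))) * s i powr - p * e i"
      using mult_left_mono[OF A, of 2] by (simp add: mult_ac)
    moreover have "(g i)\<^sup>2 * (b\<^sub>p * l i powr (2 - p)) \<le> \<gamma>\<^sup>2 * (b\<^sub>p * \<Lambda> powr (2 - p)) * s i powr - p"
      using B by (simp only: mult_ac)
    ultimately show ?thesis by (simp only: mult.assoc)
  qed
  have D1: "D g l 1 = (norm (x1 - y))\<^sup>2"
    by (simp add: D_def iterate_def prob_space)
  have "(\<Sum>i=1..n. g i * gap g l i) \<le> D g l 1
      + 2 * (\<gamma> * (a\<^sub>p / lam powr (p - 1)))\<^sup>2 * (\<Sum>i=1..n. s i powr - p)\<^sup>2
      + \<gamma>\<^sup>2 * (b\<^sub>p * \<Lambda> powr (2 - p)) * (\<Sum>i=1..n. s i powr - p)"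
  proof (rule perturbed_recursion_sum_le[where e = e])
    fix i assume i: "i \<in> {1..n}"
    then have "gap g l i \<ge> 0" by (intro gap_nonneg[OF stepsize_pos level_ge]) auto
    then show "g i * gap g l i \<ge> 0" using stepsize_pos[OF i] by simp
    show "(e i)\<^sup>2 \<le> D g l i"
      unfolding e_def using i by (intro expected_dist_square_le[OF stepsize_pos level_ge]) auto
    show "D g l (Suc i) \<le> D g l i - 2 * (g i * gap g l i)
      + 2 * (\<gamma> * (a\<^sub>p / lam powr (p - 1))) * s i powr - p * e i
      + \<gamma>\<^sup>2 * (b\<^sub>p * \<Lambda> powr (2 - p)) * s i powr - p"
      by (rule step[OF i])
  qed (use n \<gamma> e_nonneg in \<open>auto simp: D_def\<close>)
  then show ?thesis unfolding D1 \<Lambda>_def .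
qed

text \<open>The value at the average lies between \<open>f y\<close>, as the average stays in
  \<open>X\<close>, and the mean of the values at the iterates, by Jensen's inequality. The sandwich
  gives integrability, and its upper half gives the gap estimate.\<close>

lemma integrable_average:
    "integrable M (\<lambda>\<omega>. f (cssgm_avg X u m x1 g l (\<lambda>k. Y k \<omega>) n))"
  and average_gap_le:
    "expectation (\<lambda>\<omega>. f (cssgm_avg X u m x1 g l (\<lambda>k. Y k \<omega>) n)) - f y
      \<le> (1 / real n) * (\<Sum>i=1..n. gap g l i)"
proof -
  let ?avg = "\<lambda>\<omega>. cssgm_avg X u m x1 g l (\<lambda>k. Y k \<omega>) n"
  have avg: "?avg \<omega> = (\<Sum>i=1..n. (1 / real n) *\<^sub>R iterate g l \<omega> i)" for \<omega>
    by (simp add: cssgm_avg_def iterate_def scaleR_sum_right)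
  have jensen: "f (?avg \<omega>) \<le> (\<Sum>i=1..n. (1 / real n) * f (iterate g l \<omega> i))" for \<omega>
    unfolding avg using n by (intro convex_on_sum[OF _ _ f_convex]) auto
  have "?avg \<omega> \<in> X" for \<omega>
    unfolding avg using n by (intro convex_sum[OF _ X(1)] iterate_in) auto
  then have above: "f y \<le> f (?avg \<omega>)" for \<omega> using y_min by simp
  have int: "integrable M (\<lambda>\<omega>. f (iterate g l \<omega> i))" if "i \<in> {1..n}" for i
    using that by (intro integrable_f[OF stepsize_pos level_ge]) auto
  then have int_mean: "integrable M (\<lambda>\<omega>. \<Sum>i=1..n. (1 / real n) * f (iterate g l \<omega> i))"
    by (intro Bochner_Integration.integrable_sum integrable_mult_right) auto
  show int_avg: "integrable M (\<lambda>\<omega>. f (?avg \<omega>))"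
  proof (rule Bochner_Integration.integrable_bound)
    show "integrable M (\<lambda>\<omega>. \<bar>f y\<bar> + \<bar>\<Sum>i=1..n. (1 / real n) * f (iterate g l \<omega> i)\<bar>)"
      using int_mean by auto
    show "AE \<omega> in M. norm (f (?avg \<omega>))
        \<le> norm (\<bar>f y\<bar> + \<bar>\<Sum>i=1..n. (1 / real n) * f (iterate g l \<omega> i)\<bar>)"
    proof (rule AE_I2)
      fix \<omega>
      show "norm (f (?avg \<omega>))
          \<le> norm (\<bar>f y\<bar> + \<bar>\<Sum>i=1..n. (1 / real n) * f (iterate g l \<omega> i)\<bar>)"
        using above[of \<omega>] jensen[of \<omega>] unfolding real_norm_def by linarith
    qed
    show "(\<lambda>\<omega>. f (?avg \<omega>)) \<in> borel_measurable M"
      unfolding avg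
      by (intro measurable_compose[OF _ f_measurable] borel_measurable_sum borel_measurable_scaleR
          iterate_measurable) auto
  qed
  have "expectation (\<lambda>\<omega>. f (?avg \<omega>)) \<le> expectation (\<lambda>\<omega>. \<Sum>i=1..n. (1 / real n) * f (iterate g l \<omega> i))"
    using int_avg int_mean jensen by (rule integral_mono)
  also have "\<dots> = (\<Sum>i=1..n. (1 / real n) * expectation (\<lambda>\<omega>. f (iterate g l \<omega> i)))"
    using int by (subst Bochner_Integration.integral_sum) auto
  also have "\<dots> = (1 / real n) * (\<Sum>i=1..n. gap g l i) + f y"
    using n by (simp add: gap_def sum_subtractf field_simps flip: sum_divide_distrib)
  finally show "expectation (\<lambda>\<omega>. f (?avg \<omega>)) - f y \<le> (1 / real n) * (\<Sum>i=1..n. gap g l i)"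
    by simp
qed

text \<open>As \<open>s n\<close> is the largest scale, \<open>g n\<close> is the smallest stepsize,
  so the weighted gap sum dominates \<open>g n\<close> times the plain one. Dividing by
  \<open>g n = \<gamma> / s n\<close> produces the factor \<open>s n\<close>.\<close>

theorem average_rate:
  assumes mono: "\<And>i. i \<in> {1..n} \<Longrightarrow> s i \<le> s n"
    and W: "(\<Sum>i=1..n. s i powr - p) \<le> W" and "1 \<le> W"
  shows "expectation (\<lambda>\<omega>. f (cssgm_avg X u m x1 g l (\<lambda>k. Y k \<omega>) n)) - f y
    \<le> s n / real n * W\<^sup>2 * ((norm (x1 - y))\<^sup>2 / \<gamma>
        + \<gamma> * (2 * (a\<^sub>p / lam powr (p - 1))\<^sup>2 + b\<^sub>p * max ((1 + \<epsilon>) * L) lam powr (2 - p)))"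
proof -
  let ?w = "\<Sum>i=1..n. s i powr - p"
  let ?A = "a\<^sub>p / lam powr (p - 1)" and ?B = "b\<^sub>p * max ((1 + \<epsilon>) * L) lam powr (2 - p)"
  have nn: "n \<in> {1..n}" using n by simp
  have w0: "?w \<ge> 0" by (intro sum_nonneg) auto
  \<comment> \<open>Since \<open>W \<ge> 1\<close>, the single factor \<open>W^2\<close> dominates
    1, the weight sum and its square; all three terms then share one bracket.\<close>
  have W2: "1 \<le> W\<^sup>2" "W \<le> W\<^sup>2"
    using assms(3) mult_mono[of 1 W 1 W] by (auto simp: power2_eq_square)
  have B0: "?B \<ge> 0" using b\<^sub>p_nonneg by simp
  have "g n * (\<Sum>i=1..n. gap g l i) \<le> (\<Sum>i=1..n. g i * gap g l i)"
    unfolding sum_distrib_left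
  proof (rule sum_mono)
    fix i assume i: "i \<in> {1..n}"
    have "g n \<le> g i"
      using mono[OF i] s_ge[OF i] \<gamma> by (simp add: g_eq[OF i] g_eq[OF nn] frac_le)
    moreover have "gap g l i \<ge> 0" using i by (intro gap_nonneg[OF stepsize_pos level_ge]) auto
    ultimately show "g n * gap g l i \<le> g i * gap g l i" by (rule mult_right_mono)
  qed
  also have "\<dots> \<le> (norm (x1 - y))\<^sup>2 + 2 * (\<gamma> * ?A)\<^sup>2 * ?w\<^sup>2 + \<gamma>\<^sup>2 * ?B * ?w"
    by (rule weighted_gap_sum_le)
  also have "\<dots> \<le> (norm (x1 - y))\<^sup>2 * W\<^sup>2 + 2 * (\<gamma> * ?A)\<^sup>2 * W\<^sup>2 + \<gamma>\<^sup>2 * ?B * W\<^sup>2"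
  proof (intro add_mono)
    show "(norm (x1 - y))\<^sup>2 \<le> (norm (x1 - y))\<^sup>2 * W\<^sup>2"
      using W2(1) by (simp add: mult_le_cancel_left1)
    show "2 * (\<gamma> * ?A)\<^sup>2 * ?w\<^sup>2 \<le> 2 * (\<gamma> * ?A)\<^sup>2 * W\<^sup>2"
      using W w0 by (intro mult_left_mono power_mono) auto
    show "\<gamma>\<^sup>2 * ?B * ?w \<le> \<gamma>\<^sup>2 * ?B * W\<^sup>2"
      using W W2(2) B0 by (intro mult_left_mono) auto
  qed
  also have "\<dots> = W\<^sup>2 * \<gamma> * ((norm (x1 - y))\<^sup>2 / \<gamma> + \<gamma> * (2 * ?A\<^sup>2 + ?B))"
    using \<gamma> by (simp add: field_simps power2_eq_square)
  finally have "(\<Sum>i=1..n. gap g l i) \<le> s n * W\<^sup>2 * ((norm (x1 - y))\<^sup>2 / \<gamma> + \<gamma> * (2 * ?A\<^sup>2 + ?B))"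
    (is "_ \<le> _ * ?K")
    using \<gamma> s_ge[OF nn] by (simp add: g_eq[OF nn] pos_divide_le_eq mult_ac)
  then have "(1 / real n) * (\<Sum>i=1..n. gap g l i) \<le> (1 / real n) * (s n * W\<^sup>2 * ?K)"
    by (intro mult_left_mono) auto
  then show ?thesis using average_gap_le by (simp add: mult_ac)
qed

end

end

subsection \<open>Batches of independent copies\<close>

text \<open>The joint law of a batch is determined by the law of \<open>\<xi>\<close>, so any two
  batches of copies are equal in law.\<close>

lemma iid_copies_law:
  assumes "prob_space M" "iid_copies M S \<xi> I zs" "I \<noteq> {}"
  shows "distr M (PiM I (\<lambda>_. S)) (\<lambda>\<omega>. \<lambda>i\<in>I. zs i \<omega>) = PiM I (\<lambda>_. distr M S \<xi>)"
proof -
  interpret prob_space M by fact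
  have ind: "indep_vars (\<lambda>_. S) zs I" and law: "\<And>i. i \<in> I \<Longrightarrow> distr M S (zs i) = distr M S \<xi>"
    using assms(2) by (auto simp: iid_copies_def)
  have "distr M (PiM I (\<lambda>_. S)) (\<lambda>\<omega>. \<lambda>i\<in>I. zs i \<omega>) = PiM I (\<lambda>i. distr M S (zs i))"
    using indep_vars_iff_distr_eq_PiM'[OF assms(3), of zs "\<lambda>_. S"] ind by (auto simp: indep_vars_def)
  also have "\<dots> = PiM I (\<lambda>_. distr M S \<xi>)"
    using law by (intro PiM_cong) auto
  finally show ?thesis .
qed

lemma batch_mean_restrict [simp]: "batch_mean u m x (restrict z {1..m}) = batch_mean u m x z"
  by (simp add: batch_mean_def)

lemma batch_mean_measurable:
  fixes u :: "'a::{real_normed_vector, second_countable_topology} \<Rightarrow> 'z \<Rightarrow> 'a"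
  assumes [measurable]: "(\<lambda>(x, z). u x z) \<in> borel_measurable (R \<Otimes>\<^sub>M S)"
  shows "(\<lambda>(x, z). batch_mean u m x z) \<in> borel_measurable (R \<Otimes>\<^sub>M PiM {1..m} (\<lambda>_. S))"
proof -
  have "(\<lambda>w. u (fst w) (snd w j)) \<in> borel_measurable (R \<Otimes>\<^sub>M PiM {1..m} (\<lambda>_. S))"
    if "j \<in> {1..m}" for j
  proof -
    have "(\<lambda>w. (fst w, snd w j)) \<in> measurable (R \<Otimes>\<^sub>M PiM {1..m} (\<lambda>_. S)) (R \<Otimes>\<^sub>M S)"
      using that
      by (intro measurable_Pair measurable_fst
          measurable_compose[OF measurable_snd measurable_component_singleton])
    from measurable_compose[OF this assms] show ?thesis by simp
  qed
  then show ?thesis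
    unfolding batch_mean_def case_prod_unfold
    by (intro borel_measurable_scaleR borel_measurable_sum borel_measurable_const) auto
qed

text \<open>Integrability and mean depend on the law alone, so every copy inherits them from
  \<open>\<xi>\<close>; linearity does the rest.\<close>

lemma batch_mean_expectation:
  fixes u :: "'a::{real_normed_vector, banach, second_countable_topology} \<Rightarrow> 'z \<Rightarrow> 'a"
  assumes "prob_space M" and iid: "iid_copies M S \<xi> {1..m} \<zeta>" and m: "m \<ge> 1"
    and \<xi>: "\<xi> \<in> measurable M S" and u: "u x \<in> borel_measurable S"
    and int: "integrable M (\<lambda>\<omega>. u x (\<xi> \<omega>))"
  shows "integrable M (\<lambda>\<omega>. batch_mean u m x (\<lambda>j. \<zeta> j \<omega>))"
    and "(\<integral>\<omega>. batch_mean u m x (\<lambda>j. \<zeta> j \<omega>) \<partial>M) = (\<integral>\<omega>. u x (\<xi> \<omega>) \<partial>M)"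
proof -
  interpret prob_space M by fact
  have copy: "integrable M (\<lambda>\<omega>. u x (\<zeta> j \<omega>))"
    "(\<integral>\<omega>. u x (\<zeta> j \<omega>) \<partial>M) = (\<integral>\<omega>. u x (\<xi> \<omega>) \<partial>M)" if "j \<in> {1..m}" for j
  proof -
    have \<zeta>: "\<zeta> j \<in> measurable M S" and law: "distr M S (\<zeta> j) = distr M S \<xi>"
      using iid that by (auto simp: iid_copies_def indep_vars_def)
    show "integrable M (\<lambda>\<omega>. u x (\<zeta> j \<omega>))"
      using integrable_distr_eq[OF \<zeta> u] integrable_distr_eq[OF \<xi> u] int law by simp
    show "(\<integral>\<omega>. u x (\<zeta> j \<omega>) \<partial>M) = (\<integral>\<omega>. u x (\<xi> \<omega>) \<partial>M)"
      using integral_distr[OF \<zeta> u] integral_distr[OF \<xi> u] law by simp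
  qed
  show "integrable M (\<lambda>\<omega>. batch_mean u m x (\<lambda>j. \<zeta> j \<omega>))"
    unfolding batch_mean_def using copy(1)
    by (intro integrable_scaleR_right Bochner_Integration.integrable_sum)
  have "(\<integral>\<omega>. batch_mean u m x (\<lambda>j. \<zeta> j \<omega>) \<partial>M)
      = (1 / real m) *\<^sub>R (\<Sum>j=1..m. \<integral>\<omega>. u x (\<zeta> j \<omega>) \<partial>M)"
    unfolding batch_mean_def using copy(1)
    by (subst integral_scaleR_right) (subst Bochner_Integration.integral_sum, auto)
  also have "\<dots> = (1 / real m) *\<^sub>R (\<Sum>j=1..m. \<integral>\<omega>. u x (\<xi> \<omega>) \<partial>M)"
    using copy(2) by simp
  also have "\<dots> = (\<integral>\<omega>. u x (\<xi> \<omega>) \<partial>M)"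
    using m by (simp add: scaleR_conv_of_real sum_constant_scaleR)
  finally show "(\<integral>\<omega>. batch_mean u m x (\<lambda>j. \<zeta> j \<omega>) \<partial>M) = (\<integral>\<omega>. u x (\<xi> \<omega>) \<partial>M)" .
qed

text \<open>The reference batch \<open>\<zeta>\<close> carries the definition of the batch deviation
  \<open>\<sigma>\<^sub>m\<close>. Integrability belongs to the conclusion because the Bochner
  integral of a nonintegrable function is 0 by convention. In the second claim the parameters are
  prescribed only up to the horizon \<open>k\<close>.\<close>

theorem corollary1:
  fixes f :: "'a::{real_inner, banach, second_countable_topology} \<Rightarrow> real"
    and X :: "'a set"
    and u :: "'a \<Rightarrow> 'z \<Rightarrow> 'a"
    and M :: "'w measure" and S :: "'z measure"
    and \<xi> :: "'w \<Rightarrow> 'z"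
    and \<zeta> :: "nat \<Rightarrow> 'w \<Rightarrow> 'z"
    and \<xi>s :: "nat \<Rightarrow> nat \<Rightarrow> 'w \<Rightarrow> 'z"
    and m :: nat
    and L p \<sigma> \<sigma>\<^sub>m \<epsilon> a\<^sub>p b\<^sub>p L\<^sub>\<epsilon> c \<gamma> lam :: real
    and x1 x_star :: 'a
  assumes "convex_on UNIV f" and "L > 0" and "L-lipschitz_on UNIV f"
    and "X \<noteq> {}" and "closed X" and "convex X"
    and "prob_space M"
    and "\<xi> \<in> measurable M S"
    and "(\<lambda>(x, z). u x z) \<in> borel_measurable (restrict_space borel X \<Otimes>\<^sub>M S)"
    and "\<forall>x\<in>X. integrable M (\<lambda>\<omega>. u x (\<xi> \<omega>))"
    and "\<forall>x\<in>X. (\<integral>\<omega>. u x (\<xi> \<omega>) \<partial>M) \<in> subdifferential f x"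
    and "1 < p" and "p \<le> 2" and "\<sigma> \<ge> 0"
    and "\<forall>x\<in>X. (\<integral>\<^sup>+\<omega>. ennreal (norm (u x (\<xi> \<omega>) - (\<integral>\<omega>'. u x (\<xi> \<omega>') \<partial>M)) powr p) \<partial>M)
                 \<le> ennreal (\<sigma> powr p)"
    and "m \<ge> 1" and "\<epsilon> > 0"
    and "\<sigma>\<^sub>m \<ge> 0"
    and "iid_copies M S \<xi> {1..m} \<zeta>"
    and "\<forall>x\<in>X. (\<integral>\<^sup>+\<omega>. ennreal (norm (batch_mean u m x (\<lambda>j. \<zeta> j \<omega>)
                      - (\<integral>\<omega>'. batch_mean u m x (\<lambda>j. \<zeta> j \<omega>') \<partial>M)) powr p) \<partial>M)
                 \<le> ennreal (\<sigma>\<^sub>m powr p)"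
    and "a\<^sub>p = (1 + 1 / \<epsilon>) powr (p - 1) * \<sigma>\<^sub>m powr p"
    and "b\<^sub>p = 2 powr (p - 1) * (\<sigma>\<^sub>m powr p + L powr p)"
    and "L\<^sub>\<epsilon> = (1 + \<epsilon>) * L"
    and "x1 \<in> X"
    and "\<forall>k\<ge>1. iid_copies M S \<xi> {1..m} (\<xi>s k)"
    and "prob_space.indep_vars M (\<lambda>_. Pi\<^sub>M {1..m} (\<lambda>_. S)) (\<lambda>k \<omega>. \<lambda>j\<in>{1..m}. \<xi>s k j \<omega>) {1..}"
    and "\<gamma> > 0" and "lam > 0"
    and "is_arg_min f (\<lambda>x. x \<in> X) x_star"
    and "c = 2 * (a\<^sub>p / lam powr (p - 1))\<^sup>2 + b\<^sub>p * max L\<^sub>\<epsilon> lam powr (2 - p)"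
  shows "(\<forall>g l. (\<forall>k\<ge>1. g k = \<gamma> / (real k * (1 + ln (real k))) powr (1 / p)
                    \<and> l k = max L\<^sub>\<epsilon> (lam * (real k * (1 + ln (real k))) powr (1 / p)))
            \<longrightarrow> (\<forall>k\<ge>1.
                  integrable M (\<lambda>\<omega>. f (cssgm_avg X u m x1 g l (\<lambda>i j. \<xi>s i j \<omega>) k))
                  \<and> (\<integral>\<omega>. f (cssgm_avg X u m x1 g l (\<lambda>i j. \<xi>s i j \<omega>) k) \<partial>M) - (INF x\<in>X. f x)
                    \<le> (1 + ln (real k)) powr (1 / p) * (1 + ln (1 + ln (real k)))\<^sup>2
                        / real k powr ((p - 1) / p)
                      * ((norm (x1 - x_star))\<^sup>2 / \<gamma> + \<gamma> * c)))
    \<and> (\<forall>k\<ge>1. \<forall>g l. (\<forall>i\<in>{1..k}. g i = \<gamma> / real k powr (1 / p)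
                    \<and> l i = max L\<^sub>\<epsilon> (lam * real k powr (1 / p)))
            \<longrightarrow> integrable M (\<lambda>\<omega>. f (cssgm_avg X u m x1 g l (\<lambda>i j. \<xi>s i j \<omega>) k))
                  \<and> (\<integral>\<omega>. f (cssgm_avg X u m x1 g l (\<lambda>i j. \<xi>s i j \<omega>) k) \<partial>M) - (INF x\<in>X. f x)
                    \<le> 1 / real k powr ((p - 1) / p)
                      * ((norm (x1 - x_star))\<^sup>2 / \<gamma> + \<gamma> * c))"
proof -
  interpret prob_space M by fact
  let ?T = "PiM {1..m} (\<lambda>_. S)" and ?Y = "\<lambda>k \<omega>. \<lambda>j\<in>{1..m}. \<xi>s k j \<omega>"
  \<comment> \<open>This is the common law of \<open>\<zeta>\<close> and of every drawn batch;
    through it the hypotheses on \<open>\<zeta>\<close> reach the batches of the algorithm.\<close>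
  define Q where "Q = PiM {1..m} (\<lambda>_. distr M S \<xi>)"
  have Q: "Q = distr M ?T (\<lambda>\<omega>. \<lambda>j\<in>{1..m}. \<zeta> j \<omega>)"
    unfolding Q_def using assms(7,16,19) by (intro iid_copies_law[symmetric]) auto
  have \<zeta> [measurable]: "(\<lambda>\<omega>. \<lambda>j\<in>{1..m}. \<zeta> j \<omega>) \<in> measurable M ?T"
    using assms(19) by (intro measurable_restrict) (auto simp: iid_copies_def indep_vars_def)
  have x_star: "x_star \<in> X" "\<And>x. x \<in> X \<Longrightarrow> f x_star \<le> f x"
    using assms(29) by (auto simp: is_arg_min_def not_less)
  then have INF: "(INF x\<in>X. f x) = f x_star"
    by (intro cInf_eq_minimum) auto
  have batch_meas: "(\<lambda>(x, z). batch_mean u m x z) \<in> borel_measurable (restrict_space borel X \<Otimes>\<^sub>M ?T)"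
    using assms(9) by (rule batch_mean_measurable)
  have slice: "(\<lambda>z. h x z) \<in> borel_measurable N"
    if "x \<in> X" "(\<lambda>(x, z). h x z) \<in> borel_measurable (restrict_space borel X \<Otimes>\<^sub>M N)"
    for x and h :: "'a \<Rightarrow> 'c \<Rightarrow> 'a" and N
    using measurable_compose[OF measurable_Pair1' that(2), of x] that(1)
    by (simp add: space_restrict_space)
  have mean: "integrable M (\<lambda>\<omega>. batch_mean u m x (\<lambda>j. \<zeta> j \<omega>))"
    "(\<integral>\<omega>. batch_mean u m x (\<lambda>j. \<zeta> j \<omega>) \<partial>M) = (\<integral>\<omega>. u x (\<xi> \<omega>) \<partial>M)" if "x \<in> X" for x
    using batch_mean_expectation[of M S \<xi> m \<zeta> u x, OF assms(7,19,16,8) slice[OF that assms(9)]]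
      assms(10) that by blast+
  have Q_mean: "(\<integral>z. batch_mean u m x z \<partial>Q) = (\<integral>\<omega>. batch_mean u m x (\<lambda>j. \<zeta> j \<omega>) \<partial>M)"
    and Q_int: "integrable Q (batch_mean u m x)"
    and Q_moment: "(\<integral>\<^sup>+z. ennreal (norm (batch_mean u m x z - (\<integral>z. batch_mean u m x z \<partial>Q)) powr p) \<partial>Q)
      = (\<integral>\<^sup>+\<omega>. ennreal (norm (batch_mean u m x (\<lambda>j. \<zeta> j \<omega>)
                      - (\<integral>\<omega>'. batch_mean u m x (\<lambda>j. \<zeta> j \<omega>') \<partial>M)) powr p) \<partial>M)"
    if x: "x \<in> X" for x
  proof -
    have [measurable]: "batch_mean u m x \<in> borel_measurable ?T"
      using slice[OF x batch_meas] .
    show eq: "(\<integral>z. batch_mean u m x z \<partial>Q) = (\<integral>\<omega>. batch_mean u m x (\<lambda>j. \<zeta> j \<omega>) \<partial>M)"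
      unfolding Q by (subst integral_distr) (auto simp del: One_nat_def)
    show "integrable Q (batch_mean u m x)"
      unfolding Q using mean(1)[OF x] by (subst integrable_distr_eq) (auto simp del: One_nat_def)
    show "(\<integral>\<^sup>+z. ennreal (norm (batch_mean u m x z - (\<integral>z. batch_mean u m x z \<partial>Q)) powr p) \<partial>Q)
      = (\<integral>\<^sup>+\<omega>. ennreal (norm (batch_mean u m x (\<lambda>j. \<zeta> j \<omega>)
                      - (\<integral>\<omega>'. batch_mean u m x (\<lambda>j. \<zeta> j \<omega>') \<partial>M)) powr p) \<partial>M)"
      unfolding eq unfolding Q by (subst nn_integral_distr) (auto simp del: One_nat_def)
  qed
  interpret clipped_subgradient M f X u m ?T Q ?Y L p \<sigma>\<^sub>m \<epsilon> x1 x_star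
  proof unfold_locales
    show "distr M ?T (?Y k) = Q" if "k \<ge> 1" for k
      unfolding Q_def using assms(7,16,25) that by (intro iid_copies_law) auto
    show "(\<integral>z. batch_mean u m x z \<partial>Q) \<in> subdifferential f x" if "x \<in> X" for x
      using Q_mean[OF that] mean(2)[OF that] assms(11) that by simp
  qed (use assms x_star batch_meas Q_int Q_moment in \<open>auto simp del: One_nat_def\<close>)
  \<comment> \<open>Truncating a batch to the entries \<open>1..m\<close> leaves the iterates
    unchanged, since the batch mean reads only those entries.\<close>
  have avg: "cssgm_avg X u m x1 g l (\<lambda>k. ?Y k \<omega>) k = cssgm_avg X u m x1 g l (\<lambda>i j. \<xi>s i j \<omega>) k"
    for g l \<omega> k
    unfolding cssgm_avg_def
    by (intro arg_cong[where f = "scaleR (1 / real k)"] sum.cong refl cssgm_cong) auto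
  \<comment> \<open>Both claims are instances: the anytime one with
    \<open>W = 1 + ln (1 + ln k)\<close>, the finite-horizon one with \<open>W = 1\<close>.\<close>
  have rate: "integrable M (\<lambda>\<omega>. f (cssgm_avg X u m x1 g l (\<lambda>i j. \<xi>s i j \<omega>) k))
      \<and> (\<integral>\<omega>. f (cssgm_avg X u m x1 g l (\<lambda>i j. \<xi>s i j \<omega>) k) \<partial>M) - (INF x\<in>X. f x)
        \<le> s k / real k * W\<^sup>2 * ((norm (x1 - x_star))\<^sup>2 / \<gamma> + \<gamma> * c)"
    if "k \<ge> 1" "\<And>i. i \<in> {1..k} \<Longrightarrow> s i \<ge> 1" "\<And>i. i \<in> {1..k} \<Longrightarrow> s i \<le> s k"
      "\<And>i. i \<in> {1..k} \<Longrightarrow> g i = \<gamma> / s i" "\<And>i. i \<in> {1..k} \<Longrightarrow> l i = max L\<^sub>\<epsilon> (lam * s i)"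
      "(\<Sum>i=1..k. s i powr - p) \<le> W" "1 \<le> W"
    for g l s :: "nat \<Rightarrow> real" and k W
  proof -
    have l: "l i = max ((1 + \<epsilon>) * L) (lam * s i)" if "i \<in> {1..k}" for i
      using \<open>\<And>i. i \<in> {1..k} \<Longrightarrow> l i = max L\<^sub>\<epsilon> (lam * s i)\<close>[OF that] assms(23) by simp
    have int: "integrable M (\<lambda>\<omega>. f (cssgm_avg X u m x1 g l (\<lambda>k. ?Y k \<omega>) k))"
      by (rule integrable_average[where s = s]) (fact that(1) assms(27,28) that(2,4) l)+
    have rate: "(\<integral>\<omega>. f (cssgm_avg X u m x1 g l (\<lambda>k. ?Y k \<omega>) k) \<partial>M) - f x_star
      \<le> s k / real k * W\<^sup>2 * ((norm (x1 - x_star))\<^sup>2 / \<gamma>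
        + \<gamma> * (2 * (a\<^sub>p / lam powr (p - 1))\<^sup>2 + b\<^sub>p * max ((1 + \<epsilon>) * L) lam powr (2 - p)))"
      unfolding assms(21,22) a\<^sub>p_def[symmetric] b\<^sub>p_def[symmetric]
      by (rule average_rate[where s = s]) (fact that assms(27,28) l)+
    show ?thesis
      using int rate unfolding avg INF assms(23,30) ..
  qed
  have inverse_rate: "(real k) powr (1 / p) / real k = 1 / real k powr ((p - 1) / p)"
    if "k \<ge> 1" for k :: nat
  proof -
    have "(p - 1) / p = 1 - 1 / p" using assms(12) by (simp add: diff_divide_distrib)
    then show ?thesis using that by (simp add: powr_diff)
  qed
  show ?thesis
  proof (intro conjI[of "\<forall>g l. _ g l"] allI impI)
    fix g l :: "nat \<Rightarrow> real" and k :: nat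
    assume gl: "\<forall>k\<ge>1. g k = \<gamma> / (real k * (1 + ln (real k))) powr (1 / p)
        \<and> l k = max L\<^sub>\<epsilon> (lam * (real k * (1 + ln (real k))) powr (1 / p))"
      and k: "1 \<le> k"
    define s where "s i = (real i * (1 + ln (real i))) powr (1 / p)" for i :: nat
    have ge1: "1 \<le> real i * (1 + ln (real i))" if "i \<ge> 1" for i :: nat
      using mult_mono[of 1 "real i" 1 "1 + ln (real i)"] that by simp
    have s1: "s i \<ge> 1" if "i \<in> {1..k}" for i
      unfolding s_def using ge1[of i] that assms(12) by (intro ge_one_powr_ge_zero) auto
    have s_mono: "s i \<le> s k" if "i \<in> {1..k}" for i
      unfolding s_def using that assms(12) by (intro powr_mono2 mult_mono) auto
    have "(\<Sum>i=1..k. s i powr - p) = (\<Sum>i=1..k. 1 / (real i * (1 + ln (real i))))"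
    proof (rule sum.cong)
      fix i assume "i \<in> {1..k}"
      then have "0 < real i * (1 + ln (real i))" using ge1[of i] by simp
      then show "s i powr - p = 1 / (real i * (1 + ln (real i)))"
        unfolding s_def using assms(12) by (simp add: powr_powr powr_minus_divide)
    qed simp
    then have W: "(\<Sum>i=1..k. s i powr - p) \<le> 1 + ln (1 + ln (real k))"
      using sum_inverse_log_le[OF k] by simp
    have sk: "s k / real k = (1 + ln (real k)) powr (1 / p) / real k powr ((p - 1) / p)"
    proof -
      have "s k = real k powr (1 / p) * (1 + ln (real k)) powr (1 / p)"
        unfolding s_def by (rule powr_mult)
      then have "s k / real k = (1 + ln (real k)) powr (1 / p) * (real k powr (1 / p) / real k)"
        by simp
      then show ?thesis unfolding inverse_rate[OF k] by simp
    qed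
    show "integrable M (\<lambda>\<omega>. f (cssgm_avg X u m x1 g l (\<lambda>i j. \<xi>s i j \<omega>) k))
        \<and> (\<integral>\<omega>. f (cssgm_avg X u m x1 g l (\<lambda>i j. \<xi>s i j \<omega>) k) \<partial>M) - (INF x\<in>X. f x)
          \<le> (1 + ln (real k)) powr (1 / p) * (1 + ln (1 + ln (real k)))\<^sup>2
              / real k powr ((p - 1) / p)
            * ((norm (x1 - x_star))\<^sup>2 / \<gamma> + \<gamma> * c)"
      using rate[OF k s1 s_mono _ _ W, of g l] gl k unfolding sk by (simp add: s_def)
  next
    fix k :: nat and g l :: "nat \<Rightarrow> real"
    assume k: "1 \<le> k" and gl: "\<forall>i\<in>{1..k}. g i = \<gamma> / real k powr (1 / p)
        \<and> l i = max L\<^sub>\<epsilon> (lam * real k powr (1 / p))"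
    \<comment> \<open>The scale \<open>s\<close> is now constant, and each of its \<open>k\<close>
      weights equals \<open>1 / k\<close>.\<close>
    have s1: "1 \<le> real k powr (1 / p)"
      using k assms(12) by (intro ge_one_powr_ge_zero) auto
    have "(real k powr (1 / p)) powr - p = 1 / real k"
      using k assms(12) by (simp add: powr_powr powr_minus_divide)
    then have W: "(\<Sum>i=1..k. (real k powr (1 / p)) powr - p) \<le> 1" using k by simp
    show "integrable M (\<lambda>\<omega>. f (cssgm_avg X u m x1 g l (\<lambda>i j. \<xi>s i j \<omega>) k))
        \<and> (\<integral>\<omega>. f (cssgm_avg X u m x1 g l (\<lambda>i j. \<xi>s i j \<omega>) k) \<partial>M) - (INF x\<in>X. f x)
          \<le> 1 / real k powr ((p - 1) / p) * ((norm (x1 - x_star))\<^sup>2 / \<gamma> + \<gamma> * c)"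
      using rate[OF k s1 order_refl _ _ W, of g l] gl unfolding inverse_rate[OF k] by simp
  qed
qed

end
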